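(* Let $\Sigma_1,\Sigma_2$ be systems as in the context with $\Psi_1=\Psi_2$, and let $\mathcal R=\ker([R_1\ \ -R_2])\subseteq\mathbb R^{n_1}\times\mathbb R^{n_2}$, with $R_i\in\mathbb R^{r\times n_i}$, be a total relation satisfying $(h_0)$ $\mathrm{diag}(A_1,A_2)\,\mathcal R\subseteq\mathcal R$. Then $\mathcal R$ is a stochastic bisimulation relation between $\Sigma_1$ and $\Sigma_2$ if and only if: $(h_1)$ $R_1B_1=R_2B_2$; $(h_2)$ $R_1G_1\mu_1=R_2G_2\mu_2$; $(h_3)$ $R_1G_1G_1^TR_1^T=R_2G_2G_2^TR_2^T$; $(h_4)$ $\mathcal R\subseteq\ker([C_1\ \ -C_2])$; $(h_5)$ $\mathrm{im}(\mathcal{R}each(A_i,G_i))\cap\ker(R_i)=\{0\}$ for $i=1,2$.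
   Context: For $i=1,2$, $\Sigma_i$ is the system $x_i(t+1)=A_ix_i(t)+B_iu(t)+G_iw_i(t)$, $y_i(t)=C_ix_i(t)+\nu_i(t)$, $t\in\mathbb{N}$, with $x_i\in\mathbb{R}^{n_i}$, $u\in\mathbb{R}^m$, $w_i\in\mathbb{R}^{l_i}$, $y_i,\nu_i\in\mathbb{R}^p$, where $(w_i(t))_t$ is i.i.d. with $w_i(t)\sim\mathcal N(\mu_i,I_{l_i})$, $(\nu_i(t))_t$ is i.i.d. with $\nu_i(t)\sim\mathcal N(0,\Psi_i)$, and the two sequences are mutually independent. For a deterministic initial state $x_i^0$ and deterministic input $\mathbf u:\mathbb N\to\mathbb R^m$, $\mathbf x_i|_{x_i^0,\mathbf u}(t)=A_i^tx_i^0+\sum_{\tau=0}^{t-1}A_i^{t-1-\tau}(B_iu(\tau)+G_iw_i(\tau))$, $\mathbf y_i|_{x_i^0,\mathbf u}(t)=C_i\mathbf x_i|_{x_i^0,\mathbf u}(t)+\nu_i(t)$; $\mathbf P(\cdot\mid x_i^0)$ is probability for the process started at $x_i^0$. Processes are stochastically equivalent ($\sim$) if all finite-dimensional joint distributions coincide. $\mathrm{supp}(v)=\{z:\mathbf P(v\in B_\rho(z))>0\ \forall\rho>0\}$. For a relation $\mathcal R$: $\mathcal R(X_1)=\{x_2:\exists x_1\in X_1,(x_1,x_2)\in\mathcal R\}$, $\mathcal R^{-1}(X_2)=\{x_1:\exists x_2\in X_2,(x_1,x_2)\in\mathcal R\}$; total means $\mathcal R(\mathbb R^{n_1})=\mathbb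 R^{n_2}$ and $\mathcal R^{-1}(\mathbb R^{n_2})=\mathbb R^{n_1}$. A subspace $\mathcal R$ is a stochastic bisimulation relation between $\Sigma_1,\Sigma_2$ if for every $(x_1^0,x_2^0)\in\mathcal R$, every input $\mathbf u$ and every $t\in\mathbb N$: (i) for every measurable $X_1\subseteq\mathcal R^{-1}(\mathbb R^{n_2})$, $\mathbf P(\mathbf x_1|_{x_1^0,\mathbf u}(t)\in X_1\mid x_1^0)=\mathbf P(\mathbf x_2|_{x_2^0,\mathbf u}(t)\in\mathcal R(X_1\cap\mathrm{supp}(\mathbf x_1|_{x_1^0,\mathbf u}(t)))\mid x_2^0)$; (ii) for every measurable $X_2\subseteq\mathcal R(\mathbb R^{n_1})$, $\mathbf P(\mathbf x_2|_{x_2^0,\mathbf u}(t)\in X_2\mid x_2^0)=\mathbf P(\mathbf x_1|_{x_1^0,\mathbf u}(t)\in\mathcal R^{-1}(X_2\cap\mathrm{supp}(\mathbf x_2|_{x_2^0,\mathbf u}(t)))\mid x_1^0)$; (iii) $\mathbf y_1|_{x_1^0,\mathbf u}\sim\mathbf y_2|_{x_2^0,\mathbf u}$. $\mathcal{R}each(A_i,G_i)=[G_i\ A_iG_i\ \cdots\ A_i^{n_i-1}G_i]$. *)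

theory Defs
  imports "HOL-Analysis.Analysis" "HOL-Probability.Probability"
begin

text \<open>Matrix power A^k (the componentwise power on real^'n^'n is NOT the matrix power).\<close>
primrec matpow :: "real^'n^'n \<Rightarrow> nat \<Rightarrow> real^'n^'n" where
  "matpow A 0 = mat 1"
| "matpow A (Suc k) = A ** matpow A k"

text \<open>Gaussian random vector X ~ N(m, S) on the probability space M, defined in the
  standard (Cramer--Wold) way: every linear functional a.X is (possibly degenerate)
  normal with mean a.m and variance a^T S a.\<close>
definition gaussian_vec :: "'s measure \<Rightarrow> ('s \<Rightarrow> real^'k) \<Rightarrow> real^'k \<Rightarrow> real^'k^'k \<Rightarrow> bool" where
  "gaussian_vec M X m S \<longleftrightarrow> X \<in> borel_measurable M \<and> (\<forall>a. a \<bullet> (S *v a) \<ge> 0) \<and>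
     (\<forall>a. if a \<bullet> (S *v a) = 0
          then distr M borel (\<lambda>\<omega>. a \<bullet> X \<omega>) = return borel (a \<bullet> m)
          else distributed M lborel (\<lambda>\<omega>. a \<bullet> X \<omega>)
                 (\<lambda>x. ennreal (normal_density (a \<bullet> m) (sqrt (a \<bullet> (S *v a))) x)))"

text \<open>Noise model of one system: on the probability space M, w(t) i.i.d. N(mu, I),
  nu(t) i.i.d. N(0, Psi), the sequences (w(t))_t and (nu(t))_t mutually independent
  (equivalently: the pairs (w(t),nu(t)) are independent over t and w(t), nu(t) are
  independent for each t).\<close>
definition noise_model :: "'s measure \<Rightarrow> (nat \<Rightarrow> 's \<Rightarrow> real^'l) \<Rightarrow> real^'l
     \<Rightarrow> (nat \<Rightarrow> 's \<Rightarrow> real^'p) \<Rightarrow> real^'p^'p \<Rightarrow> bool" where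
  "noise_model M w mu nu Psi \<longleftrightarrow> prob_space M \<and>
     (\<forall>t. gaussian_vec M (w t) mu (mat 1)) \<and>
     (\<forall>t. gaussian_vec M (nu t) 0 Psi) \<and>
     (\<forall>t. distr M (borel \<Otimes>\<^sub>M borel) (\<lambda>\<omega>. (w t \<omega>, nu t \<omega>)) =
        distr M borel (w t) \<Otimes>\<^sub>M distr M borel (nu t)) \<and>
     prob_space.indep_vars M (\<lambda>_. borel) (\<lambda>t \<omega>. (w t \<omega>, nu t \<omega>)) UNIV"

definition state :: "real^'n^'n \<Rightarrow> real^'m^'n \<Rightarrow> real^'l^'n \<Rightarrow> (nat \<Rightarrow> 's \<Rightarrow> real^'l)
     \<Rightarrow> real^'n \<Rightarrow> (nat \<Rightarrow> real^'m) \<Rightarrow> nat \<Rightarrow> 's \<Rightarrow> real^'n" where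
  "state A B G w x0 u t \<omega> = matpow A t *v x0 +
     (\<Sum>\<tau><t. matpow A (t - 1 - \<tau>) *v (B *v u \<tau> + G *v w \<tau> \<omega>))"

definition sys_output :: "real^'n^'n \<Rightarrow> real^'m^'n \<Rightarrow> real^'l^'n \<Rightarrow> real^'n^'p
     \<Rightarrow> (nat \<Rightarrow> 's \<Rightarrow> real^'l) \<Rightarrow> (nat \<Rightarrow> 's \<Rightarrow> real^'p)
     \<Rightarrow> real^'n \<Rightarrow> (nat \<Rightarrow> real^'m) \<Rightarrow> nat \<Rightarrow> 's \<Rightarrow> real^'p" where
  "sys_output A B G C w nu x0 u t \<omega> = C *v state A B G w x0 u t \<omega> + nu t \<omega>"

definition supp :: "'s measure \<Rightarrow> ('s \<Rightarrow> 'a::metric_space) \<Rightarrow> 'a set" where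
  "supp M X = {z. \<forall>\<rho>>0. measure M {\<omega> \<in> space M. X \<omega> \<in> ball z \<rho>} > 0}"

definition stoch_equiv :: "'s measure \<Rightarrow> (nat \<Rightarrow> 's \<Rightarrow> 'a::topological_space)
     \<Rightarrow> 's2 measure \<Rightarrow> (nat \<Rightarrow> 's2 \<Rightarrow> 'a) \<Rightarrow> bool" where
  "stoch_equiv M Y N Z \<longleftrightarrow> (\<forall>J. finite J \<longrightarrow>
     distr M (PiM J (\<lambda>_. borel)) (\<lambda>\<omega>. \<lambda>t\<in>J. Y t \<omega>) =
     distr N (PiM J (\<lambda>_. borel)) (\<lambda>\<omega>. \<lambda>t\<in>J. Z t \<omega>))"

definition kerrel :: "real^'n1^'r \<Rightarrow> real^'n2^'r \<Rightarrow> ((real^'n1) \<times> (real^'n2)) set" where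
  "kerrel R1 R2 = {(x1, x2). R1 *v x1 = R2 *v x2}"

definition total_rel :: "('a \<times> 'b) set \<Rightarrow> bool" where
  "total_rel R \<longleftrightarrow> R `` UNIV = UNIV \<and> converse R `` UNIV = UNIV"

text \<open>im(Reach(A,G)) with Reach(A,G) = [G AG ... A^{n-1}G], n = CARD('n):
  the image of the block matrix applied to a stacked vector (v_0,...,v_{n-1}).\<close>
definition reach_image :: "real^'n^'n \<Rightarrow> real^'l^'n \<Rightarrow> (real^'n) set" where
  "reach_image A G = {(\<Sum>k<CARD('n). matpow A k ** G *v v k) | v :: nat \<Rightarrow> real^'l. True}"

definition stoch_bisim ::
  "((real^'n1) \<times> (real^'n2)) set
   \<Rightarrow> real^'n1^'n1 \<Rightarrow> real^'m^'n1 \<Rightarrow> real^'l1^'n1 \<Rightarrow> real^'n1^'p \<Rightarrow> 's1 measure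
   \<Rightarrow> (nat \<Rightarrow> 's1 \<Rightarrow> real^'l1) \<Rightarrow> (nat \<Rightarrow> 's1 \<Rightarrow> real^'p)
   \<Rightarrow> real^'n2^'n2 \<Rightarrow> real^'m^'n2 \<Rightarrow> real^'l2^'n2 \<Rightarrow> real^'n2^'p \<Rightarrow> 's2 measure
   \<Rightarrow> (nat \<Rightarrow> 's2 \<Rightarrow> real^'l2) \<Rightarrow> (nat \<Rightarrow> 's2 \<Rightarrow> real^'p) \<Rightarrow> bool" where
  "stoch_bisim R A1 B1 G1 C1 M1 w1 nu1 A2 B2 G2 C2 M2 w2 nu2 \<longleftrightarrow>
     subspace R \<and>
     (\<forall>x10 x20 u t. (x10, x20) \<in> R \<longrightarrow>
        (let X1 = state A1 B1 G1 w1 x10 u t; X2 = state A2 B2 G2 w2 x20 u t in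
          (\<forall>S1 \<in> sets borel. S1 \<subseteq> converse R `` UNIV \<longrightarrow>
             measure M1 {\<omega> \<in> space M1. X1 \<omega> \<in> S1} =
             measure M2 {\<omega> \<in> space M2. X2 \<omega> \<in> R `` (S1 \<inter> supp M1 X1)}) \<and>
          (\<forall>S2 \<in> sets borel. S2 \<subseteq> R `` UNIV \<longrightarrow>
             measure M2 {\<omega> \<in> space M2. X2 \<omega> \<in> S2} =
             measure M1 {\<omega> \<in> space M1. X1 \<omega> \<in> converse R `` (S2 \<inter> supp M2 X2)}) \<and>
          stoch_equiv M1 (sys_output A1 B1 G1 C1 w1 nu1 x10 u) M2 (sys_output A2 B2 G2 C2 w2 nu2 x20 u)))"

end

theory Submission
  imports Defs
begin

text \<open>
  By \<open>(h\<^sub>0)\<close> and totality, \<open>R\<^sub>1 x\<^sub>1\<close> and \<open>R\<^sub>2 x\<^sub>2\<close> obey one common linear recursion, driven by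
  \<open>R\<^sub>i B\<^sub>i u\<close> and \<open>R\<^sub>i G\<^sub>i w\<^sub>i\<close>. Under \<open>(h\<^sub>1)\<close>--\<open>(h\<^sub>4)\<close> the two driving noises have the same law, so the
  \<open>R\<^sub>i x\<^sub>i\<close> and the outputs agree in law; by \<open>(h\<^sub>5)\<close> the map \<open>R\<^sub>i\<close> is injective on the support of the
  state, so events for \<open>x\<^sub>i\<close> can be read off \<open>R\<^sub>i x\<^sub>i\<close>. Conversely, bisimilarity forces \<open>R\<^sub>1 x\<^sub>1(t)\<close>
  and \<open>R\<^sub>2 x\<^sub>2(t)\<close> to agree in law: comparing means and covariances at \<open>t = 1\<close> gives
  \<open>(h\<^sub>1)\<close>--\<open>(h\<^sub>3)\<close>, the output at \<open>t = 0\<close> gives \<open>(h\<^sub>4)\<close>, and \<open>(h\<^sub>5)\<close> holds because the support of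
  the state at \<open>t = n\<^sub>i\<close> is invariant under translation by the image of the reachability matrix.
  Gaussian laws are identified through their characteristic functions.
\<close>

section \<open>Uniqueness of multivariate characteristic functions\<close>

text \<open>The phase \<open>b\<close> covers sines as well and keeps the class closed under
  products, so it is an algebra. Each generator is the real part of a rotated character, which ties
  its integral to the characteristic function.\<close>

inductive trig_poly :: "('a::euclidean_space \<Rightarrow> real) \<Rightarrow> bool" where
  cos: "trig_poly (\<lambda>x. cos (a \<bullet> x + b))"
| scale: "trig_poly f \<Longrightarrow> trig_poly (\<lambda>x. c * f x)"
| add: "trig_poly f \<Longrightarrow> trig_poly g \<Longrightarrow> trig_poly (\<lambda>x. f x + g x)"

lemma trig_poly_const: "trig_poly (\<lambda>x. c)"
  using trig_poly.scale[OF trig_poly.cos[of 0 0], of c] by simp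

lemma trig_poly_sum:
  "finite I \<Longrightarrow> (\<And>i. i \<in> I \<Longrightarrow> trig_poly (f i)) \<Longrightarrow> trig_poly (\<lambda>x. \<Sum>i\<in>I. f i x)"
  by (induction I rule: finite_induct) (auto intro: trig_poly_const trig_poly.add)

lemma trig_poly_cos_mult:
  assumes "trig_poly f"
  shows "trig_poly (\<lambda>x. cos (a \<bullet> x + b) * f x)"
  using assms
proof (induction rule: trig_poly.induct)
  case (cos a' b')
  have "(\<lambda>x. cos (a \<bullet> x + b) * cos (a' \<bullet> x + b')) =
      (\<lambda>x. 1 / 2 * cos ((a - a') \<bullet> x + (b - b')) + 1 / 2 * cos ((a + a') \<bullet> x + (b + b')))"
  proof
    fix x
    have "(a - a') \<bullet> x + (b - b') = (a \<bullet> x + b) - (a' \<bullet> x + b')"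
      "(a + a') \<bullet> x + (b + b') = (a \<bullet> x + b) + (a' \<bullet> x + b')"
      by (simp_all add: inner_diff_left inner_add_left)
    then show "cos (a \<bullet> x + b) * cos (a' \<bullet> x + b') =
        1 / 2 * cos ((a - a') \<bullet> x + (b - b')) + 1 / 2 * cos ((a + a') \<bullet> x + (b + b'))"
      by (simp only: cos_times_cos) (simp add: add_divide_distrib)
  qed
  then show ?case
    by (simp only:) (intro trig_poly.intros)
next
  case (scale f c)
  have "(\<lambda>x. cos (a \<bullet> x + b) * (c * f x)) = (\<lambda>x. c * (cos (a \<bullet> x + b) * f x))"
    by (simp add: ac_simps)
  with trig_poly.scale[OF scale.IH, of c] show ?case by simp
next
  case (add f g)
  then show ?case by (simp add: distrib_left trig_poly.add)
qed

lemma trig_poly_mult: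
  assumes "trig_poly f" "trig_poly g"
  shows "trig_poly (\<lambda>x. f x * g x)"
  using assms
proof (induction rule: trig_poly.induct)
  case (cos a b)
  then show ?case by (rule trig_poly_cos_mult)
next
  case (scale f c)
  then show ?case using trig_poly.scale[of "\<lambda>x. f x * g x" c] by (simp add: ac_simps)
next
  case (add f1 f2)
  then show ?case by (simp add: distrib_right trig_poly.add)
qed

text \<open>Polynomials arise from linear forms by sums and products, and trigonometric polynomials
  form an algebra that contains the coordinates of \<open>g\<close>.\<close>

lemma trig_poly_polynomial_comp:
  assumes "real_polynomial_function p"
    and g: "\<And>i. i \<in> Basis \<Longrightarrow> trig_poly (\<lambda>x. g x \<bullet> i)"
  shows "trig_poly (\<lambda>x. p (g x))"
  using assms(1)
proof (induction rule: real_polynomial_function.induct)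
  case (linear f)
  then interpret bounded_linear f .
  have "f (g x) = (\<Sum>i\<in>Basis. f i * (g x \<bullet> i))" for x
    by (subst euclidean_representation[symmetric, of "g x"]) (simp add: sum scaleR mult.commute)
  then show ?case
    by (simp only:) (intro trig_poly_sum trig_poly.scale g finite_Basis)
qed (auto intro: trig_poly_const trig_poly.add trig_poly_mult)

lemma trig_poly_integral_eq:
  fixes P Q :: "'a::euclidean_space measure"
  assumes "prob_space P" "prob_space Q"
    and [measurable_cong]: "sets P = sets borel" "sets Q = sets borel"
    and char: "\<And>a. (CLINT x|P. iexp (a \<bullet> x)) = (CLINT x|Q. iexp (a \<bullet> x))"
    and "trig_poly f"
  shows "integrable P f \<and> integrable Q f \<and> (LINT x|P. f x) = (LINT x|Q. f x)"
  using assms(6)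
proof (induction rule: trig_poly.induct)
  case (cos a b)
  interpret P: prob_space P by fact
  interpret Q: prob_space Q by fact
  have intP: "integrable P (\<lambda>x. cos (a \<bullet> x + b))" and intQ: "integrable Q (\<lambda>x. cos (a \<bullet> x + b))"
    by (auto intro!: P.integrable_const_bound[where B=1] Q.integrable_const_bound[where B=1])
  have iP: "integrable P (\<lambda>x. iexp (a \<bullet> x))" and iQ: "integrable Q (\<lambda>x. iexp (a \<bullet> x))"
    by (auto intro!: P.integrable_iexp Q.integrable_iexp)
  \<comment> \<open>The phase becomes the constant factor \<open>iexp b\<close>, leaving a value of
    the characteristic function.\<close>
  have eq: "cos (a \<bullet> x + b) = Re (iexp b * iexp (a \<bullet> x))" for x
    by (simp add: cos_add Re_exp Im_exp)
  have "(LINT x|P. cos (a \<bullet> x + b)) = Re (CLINT x|P. iexp b * iexp (a \<bullet> x))"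
    unfolding eq by (rule integral_Re) (use iP in simp)
  also have "\<dots> = Re (CLINT x|Q. iexp b * iexp (a \<bullet> x))"
    using char[of a] by simp
  also have "\<dots> = (LINT x|Q. cos (a \<bullet> x + b))"
    unfolding eq by (rule integral_Re[symmetric]) (use iQ in simp)
  finally show ?case using intP intQ by simp
qed auto

text \<open>Indicators of closed sets are bounded pointwise limits of continuous functions of the
  distance, and closed sets form an intersection-stable generator of the Borel sets.\<close>

lemma prob_measure_eqI_continuous:
  fixes P Q :: "'a::euclidean_space measure"
  assumes "prob_space P" "prob_space Q"
    and [measurable_cong]: "sets P = sets borel" "sets Q = sets borel"
    and eq: "\<And>f :: 'a \<Rightarrow> real. continuous_on UNIV f \<Longrightarrow> (\<And>x. \<bar>f x\<bar> \<le> 1) \<Longrightarrow>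
      (LINT x|P. f x) = (LINT x|Q. f x)"
  shows "P = Q"
proof -
  interpret P: prob_space P by fact
  interpret Q: prob_space Q by fact
  have closed_eq: "measure P C = measure Q C" if C: "closed C" "C \<noteq> {}" for C :: "'a set"
  proof -
    \<comment> \<open>This is 1 on \<open>C\<close> and, for \<open>k > 0\<close>, vanishes at
      distance \<open>1 / k\<close> or more from \<open>C\<close>.\<close>
    define f where "f k x = max 0 (1 - real k * infdist x C)" for k x
    have cont: "continuous_on UNIV (f k)" for k
      unfolding f_def by (intro continuous_intros)
    have [measurable]: "f k \<in> borel_measurable borel" for k
      using cont by (rule borel_measurable_continuous_onI)
    have [measurable]: "C \<in> sets borel" using C by simp
    have bound: "\<bar>f k x\<bar> \<le> 1" for k x
      by (auto simp: f_def max_def infdist_nonneg)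
    have lim: "(\<lambda>k. f k x) \<longlonglongrightarrow> indicator C x" for x
    proof (cases "x \<in> C")
      case True
      then show ?thesis by (simp add: f_def)
    next
      case False
      then have pos: "infdist x C > 0"
        using C by (simp add: infdist_pos_not_in_closed)
      obtain n :: nat where n: "real n * infdist x C > 1"
        using reals_Archimedean3[OF pos] by blast
      have "f k x = 0" if "k \<ge> n" for k
      proof -
        have "real n * infdist x C \<le> real k * infdist x C"
          using that pos by (intro mult_right_mono) auto
        then show ?thesis using n by (simp add: f_def)
      qed
      then have "eventually (\<lambda>k. f k x = 0) sequentially"
        by (auto simp: eventually_sequentially)
      with False show ?thesis by (simp add: tendsto_eventually)
    qed
    have "(\<lambda>k. LINT x|P. f k x) \<longlonglongrightarrow> (LINT x|P. indicator C x)"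
      by (rule integral_dominated_convergence[where w="\<lambda>_. 1"]) (use lim bound in auto)
    moreover have "(\<lambda>k. LINT x|Q. f k x) \<longlonglongrightarrow> (LINT x|Q. indicator C x)"
      by (rule integral_dominated_convergence[where w="\<lambda>_. 1"]) (use lim bound in auto)
    moreover have "(LINT x|P. f k x) = (LINT x|Q. f k x)" for k
      by (rule eq[OF cont bound])
    ultimately have "(LINT x|P. indicator C x) = (LINT x|Q. indicator C x :: real)"
      by (simp add: LIMSEQ_unique)
    then show ?thesis by (simp add: sets_eq_imp_space_eq[OF assms(3)] sets_eq_imp_space_eq[OF assms(4)])
  qed
  have sets: "sets borel = sigma_sets UNIV {C :: 'a set. closed C}"
    by (subst borel_eq_closed) simp
  show ?thesis
  proof (rule measure_eqI_generator_eq[where E="{C. closed C}" and A="\<lambda>_. UNIV" and \<Omega>=UNIV])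
    show "Int_stable {C :: 'a set. closed C}" by (auto simp: Int_stable_def)
    show "emeasure P C = emeasure Q C" if "C \<in> {C. closed C}" for C
      using closed_eq[of C] that
      by (cases "C = {}") (auto simp: P.emeasure_eq_measure Q.emeasure_eq_measure)
    show "sets P = sigma_sets UNIV {C. closed C}" "sets Q = sigma_sets UNIV {C. closed C}"
      using assms(3,4) sets by simp_all
  qed (auto simp: P.emeasure_eq_measure)
qed

text \<open>On \<open>[-pi, pi]\<close> cosine is even and strictly decreasing in the modulus; this
  turns a bound on a cosine back into a bound on a coordinate.\<close>

lemma cos_less_cos_iff_abs:
  fixes u v :: real
  assumes "\<bar>u\<bar> \<le> pi" "0 \<le> v" "v \<le> pi"
  shows "cos v < cos u \<longleftrightarrow> \<bar>u\<bar> < v"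
  using cos_mono_less_eq[of v "\<bar>u\<bar>"] assms by simp

text \<open>Fourier uniqueness. The bounded vector with coordinates \<open>cos (s * (x - c) \<bullet> i)\<close> has
  a law determined by its polynomial moments, which are values of the characteristic function.
  For \<open>s \<rightarrow> 0\<close> the event that all these coordinates exceed \<open>cos (s * r \<bullet> i)\<close> becomes
  the open box with centre \<open>c\<close> and half-widths \<open>r \<bullet> i\<close>.\<close>

theorem prob_measure_eqI_char:
  fixes P Q :: "'a::euclidean_space measure"
  assumes "prob_space P" "prob_space Q"
    and sets [measurable_cong]: "sets P = sets borel" "sets Q = sets borel"
    and char: "\<And>a. (CLINT x|P. iexp (a \<bullet> x)) = (CLINT x|Q. iexp (a \<bullet> x))"
  shows "P = Q"
proof -
  interpret P: prob_space P by fact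
  interpret Q: prob_space Q by fact
  have sp: "space P = UNIV" "space Q = UNIV"
    using sets_eq_imp_space_eq[OF sets(1)] sets_eq_imp_space_eq[OF sets(2)] by auto
  define g :: "real \<Rightarrow> 'a \<Rightarrow> 'a \<Rightarrow> 'a" where
    "g s c x = (\<Sum>i\<in>Basis. cos (s * ((x - c) \<bullet> i)) *\<^sub>R i)" for s c x
  have g_inner: "g s c x \<bullet> i = cos (s * ((x - c) \<bullet> i))" if "i \<in> Basis" for s c x i
    using that by (simp add: g_def)
  have g_trig: "trig_poly (\<lambda>x. g s c x \<bullet> i)" if "i \<in> Basis" for s c i
  proof -
    have "g s c x \<bullet> i = cos ((s *\<^sub>R i) \<bullet> x + (- s * (c \<bullet> i)))" for x
      by (simp add: g_inner[OF that] inner_diff_left right_diff_distrib inner_commute[of x])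
    then show ?thesis by (simp only: trig_poly.cos)
  qed
  have g_meas [measurable]: "g s c \<in> borel_measurable borel" for s c
    unfolding g_def by measurable
  have g_cbox: "g s c x \<in> cbox (- One) One" for s c x
    by (simp add: mem_box g_inner)
  have g_law: "distr P borel (g s c) = distr Q borel (g s c)" for s c
  proof (rule prob_measure_eqI_continuous)
    show "prob_space (distr P borel (g s c))" by (rule P.prob_space_distr) measurable
    show "prob_space (distr Q borel (g s c))" by (rule Q.prob_space_distr) measurable
    fix f :: "'a \<Rightarrow> real"
    assume f: "continuous_on UNIV f" and f1: "\<And>x. \<bar>f x\<bar> \<le> 1"
    have [measurable]: "f \<in> borel_measurable borel"
      using f by (rule borel_measurable_continuous_onI)
    have intP: "integrable P (\<lambda>x. f (g s c x))" and intQ: "integrable Q (\<lambda>x. f (g s c x))"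
      using f1 by (auto intro!: P.integrable_const_bound[where B=1] Q.integrable_const_bound[where B=1])
    have "\<bar>(LINT x|P. f (g s c x)) - (LINT x|Q. f (g s c x))\<bar> \<le> e" if e: "e > 0" for e
    proof -
      \<comment> \<open>Stone-Weierstrass on the cube that contains the range of
        \<open>g s c\<close>. The composite \<open>p (g s c x)\<close> is a trigonometric
        polynomial, so its two integrals agree; \<open>e / 2\<close> is spent once for each
        measure.\<close>
      obtain p where p: "real_polynomial_function p"
          "\<And>y. y \<in> cbox (- One) One \<Longrightarrow> \<bar>f y - p y\<bar> < e / 2"
        by (rule Stone_Weierstrass_real_polynomial_function[of "cbox (- One) One" f "e / 2"])
          (use continuous_on_subset[OF f] e in auto)
      have pg: "integrable P (\<lambda>x. p (g s c x)) \<and> integrable Q (\<lambda>x. p (g s c x)) \<and>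
          (LINT x|P. p (g s c x)) = (LINT x|Q. p (g s c x))"
        by (intro trig_poly_integral_eq[OF assms] trig_poly_polynomial_comp[OF p(1), where g="g s c"] g_trig)
      have close: "\<bar>f (g s c x) - p (g s c x)\<bar> \<le> e / 2" for x
        using p(2)[OF g_cbox[of s c x]] by simp
      have "\<bar>(LINT x|P. f (g s c x)) - (LINT x|P. p (g s c x))\<bar> =
          \<bar>LINT x|P. f (g s c x) - p (g s c x)\<bar>"
        using intP pg by simp
      also have "\<dots> \<le> (LINT x|P. \<bar>f (g s c x) - p (g s c x)\<bar>)" by (rule integral_abs_bound)
      also have "\<dots> \<le> (LINT x|P. e / 2)"
        using intP pg close by (intro integral_mono) auto
      finally have 1: "\<bar>(LINT x|P. f (g s c x)) - (LINT x|P. p (g s c x))\<bar> \<le> e / 2"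
        by (simp add: P.prob_space)
      have "\<bar>(LINT x|Q. f (g s c x)) - (LINT x|Q. p (g s c x))\<bar> =
          \<bar>LINT x|Q. f (g s c x) - p (g s c x)\<bar>"
        using intQ pg by simp
      also have "\<dots> \<le> (LINT x|Q. \<bar>f (g s c x) - p (g s c x)\<bar>)" by (rule integral_abs_bound)
      also have "\<dots> \<le> (LINT x|Q. e / 2)"
        using intQ pg close by (intro integral_mono) auto
      finally have 2: "\<bar>(LINT x|Q. f (g s c x)) - (LINT x|Q. p (g s c x))\<bar> \<le> e / 2"
        by (simp add: Q.prob_space)
      from 1 2 pg show ?thesis by linarith
    qed
    then have "\<bar>(LINT x|P. f (g s c x)) - (LINT x|Q. f (g s c x))\<bar> \<le> 0"
      by (rule field_le_epsilon[of _ 0, simplified])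
    then show "(LINT x|distr P borel (g s c). f x) = (LINT x|distr Q borel (g s c). f x)"
      by (simp add: integral_distr)
  qed simp_all
  have box_eq: "measure P (box a b) = measure Q (box a b)" if ne: "box a b \<noteq> {}" for a b
  proof -
    define c where "c = (1 / 2) *\<^sub>R (a + b)"
    define r where "r = (1 / 2) *\<^sub>R (b - a)"
    define E where "E n = {y :: 'a. \<forall>i\<in>Basis. cos (r \<bullet> i / real (Suc n)) < y \<bullet> i}" for n
    have [measurable]: "E n \<in> sets borel" for n
      unfolding E_def by measurable
    have rpos: "r \<bullet> i > 0" if "i \<in> Basis" for i
      using ne that by (auto simp: r_def box_ne_empty inner_diff_left)
    have box: "x \<in> box a b \<longleftrightarrow> (\<forall>i\<in>Basis. \<bar>(x - c) \<bullet> i\<bar> < r \<bullet> i)" for x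
      by (auto simp: mem_box c_def r_def inner_diff_left inner_add_left abs_less_iff field_simps)
    have lim: "(\<lambda>n. indicator (E n) (g (1 / real (Suc n)) c x) :: real) \<longlonglongrightarrow> indicator (box a b) x" for x
    proof -
      \<comment> \<open>For large \<open>n\<close> all arguments lie in \<open>[-pi, pi]\<close>,
        where \<open>cos_less_cos_iff_abs\<close> applies; hence the indicators are eventually
        constant in \<open>n\<close>.\<close>
      have "eventually (\<lambda>n. \<bar>(x - c) \<bullet> i\<bar> / real (Suc n) \<le> pi \<and> r \<bullet> i / real (Suc n) \<le> pi) sequentially"
        for i
      proof -
        have "(\<lambda>n. t / real (Suc n)) \<longlonglongrightarrow> 0" for t :: real
          using LIMSEQ_Suc[OF lim_const_over_n[of t]] by simp
        then have "eventually (\<lambda>n. t / real (Suc n) < pi) sequentially" for t :: real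
          using order_tendstoD(2) pi_gt_zero by blast
        from eventually_conj[OF this[of "\<bar>(x - c) \<bullet> i\<bar>"] this[of "r \<bullet> i"]]
        show ?thesis by (rule eventually_mono) auto
      qed
      then have "eventually (\<lambda>n. \<forall>i\<in>Basis. \<bar>(x - c) \<bullet> i\<bar> / real (Suc n) \<le> pi \<and>
          r \<bullet> i / real (Suc n) \<le> pi) sequentially"
        by (simp add: eventually_ball_finite_distrib del: of_nat_Suc)
      then have "eventually (\<lambda>n. indicator (E n) (g (1 / real (Suc n)) c x) =
          (indicator (box a b) x :: real)) sequentially"
      proof (rule eventually_mono)
        fix n
        assume n: "\<forall>i\<in>Basis. \<bar>(x - c) \<bullet> i\<bar> / real (Suc n) \<le> pi \<and> r \<bullet> i / real (Suc n) \<le> pi"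
        have "cos (r \<bullet> i / real (Suc n)) < g (1 / real (Suc n)) c x \<bullet> i \<longleftrightarrow> \<bar>(x - c) \<bullet> i\<bar> < r \<bullet> i"
          if i: "i \<in> Basis" for i
          using cos_less_cos_iff_abs[of "(x - c) \<bullet> i / real (Suc n)" "r \<bullet> i / real (Suc n)"] n i rpos[OF i]
          by (simp add: g_inner abs_divide divide_less_cancel del: of_nat_Suc)
        then show "indicator (E n) (g (1 / real (Suc n)) c x) = (indicator (box a b) x :: real)"
          by (auto simp: E_def box indicator_def)
      qed
      then show ?thesis by (rule tendsto_eventually)
    qed
    have "(\<lambda>n. LINT x|P. indicator (E n) (g (1 / real (Suc n)) c x)) \<longlonglongrightarrow> (LINT x|P. indicator (box a b) x :: real)"
      by (rule integral_dominated_convergence[where w="\<lambda>_. 1"]) (use lim in \<open>auto simp: indicator_def\<close>)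
    moreover have "(\<lambda>n. LINT x|Q. indicator (E n) (g (1 / real (Suc n)) c x)) \<longlonglongrightarrow> (LINT x|Q. indicator (box a b) x :: real)"
      by (rule integral_dominated_convergence[where w="\<lambda>_. 1"]) (use lim in \<open>auto simp: indicator_def\<close>)
    moreover have "(LINT x|P. indicator (E n) (g s c x) :: real) = (LINT x|Q. indicator (E n) (g s c x))" for n s
    proof -
      have "(LINT x|distr P borel (g s c). indicator (E n) x :: real) = (LINT x|distr Q borel (g s c). indicator (E n) x)"
        by (simp add: g_law)
      then show ?thesis by (subst (asm) (1 2) integral_distr) auto
    qed
    ultimately have "(LINT x|P. indicator (box a b) x :: real) = (LINT x|Q. indicator (box a b) x)"
      by (simp add: LIMSEQ_unique)
    then show ?thesis by (simp add: sp)
  qed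
  show ?thesis
  proof (rule measure_eqI_generator_eq[where E="range (\<lambda>(a, b). box a b)" and \<Omega>=UNIV
        and A="\<lambda>n::nat. box (- (real n *\<^sub>R One)) (real n *\<^sub>R One)"])
    show "Int_stable (range (\<lambda>(a, b). box a b :: 'a set))"
      by (auto simp: Int_stable_def box_Int_box)
    show "emeasure P X = emeasure Q X" if X: "X \<in> range (\<lambda>(a, b). box a b)" for X
    proof -
      obtain a b where "X = box a b" using X by auto
      then show ?thesis using box_eq[of a b]
        by (cases "box a b = {}") (auto simp: P.emeasure_eq_measure Q.emeasure_eq_measure)
    qed
    show "sets P = sigma_sets UNIV (range (\<lambda>(a, b). box a b))"
      "sets Q = sigma_sets UNIV (range (\<lambda>(a, b). box a b))"
      by (simp_all add: sets borel_eq_box)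
    show "(\<Union>n::nat. box (- (real n *\<^sub>R One)) (real n *\<^sub>R One)) = (UNIV :: 'a set)"
      by (rule UN_box_eq_UNIV)
  qed (auto simp: P.emeasure_eq_measure)
qed

section \<open>Gaussian vectors and their supports\<close>

text \<open>Prescribing the characteristic function treats degenerate and nondegenerate laws alike.
  The variance form \<open>q\<close> is an arbitrary function here, so sums and linear images need
  no covariance matrices; quadratic scaling is assumed where supports need it.\<close>

definition gauss_char :: "'s measure \<Rightarrow> ('s \<Rightarrow> 'a::euclidean_space) \<Rightarrow> 'a \<Rightarrow> ('a \<Rightarrow> real) \<Rightarrow> bool" where
  "gauss_char M X m q \<longleftrightarrow> X \<in> borel_measurable M \<and>
     (\<forall>a. (CLINT \<omega>|M. iexp (a \<bullet> X \<omega>)) = iexp (a \<bullet> m) * of_real (exp (- q a / 2)))"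

text \<open>Zero variance gives a point mass in direction \<open>a\<close>; otherwise
  \<open>a \<bullet> X\<close> is standardised and the characteristic function of the standard
  normal law is evaluated at \<open>\<sigma>\<close>.\<close>

lemma gauss_char_gaussian_vec:
  assumes "prob_space M" "gaussian_vec M X m S"
  shows "gauss_char M X m (\<lambda>a. a \<bullet> (S *v a))"
  unfolding gauss_char_def
proof (intro conjI allI)
  interpret prob_space M by fact
  show X [measurable]: "X \<in> borel_measurable M"
    using assms(2) by (simp add: gaussian_vec_def)
  fix a
  show "(CLINT \<omega>|M. iexp (a \<bullet> X \<omega>)) = iexp (a \<bullet> m) * of_real (exp (- (a \<bullet> (S *v a)) / 2))"
  proof (cases "a \<bullet> (S *v a) = 0")
    case True
    then have "distr M borel (\<lambda>\<omega>. a \<bullet> X \<omega>) = return borel (a \<bullet> m)"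
      using assms(2) by (simp add: gaussian_vec_def split: if_splits)
    then have "(CLINT x|distr M borel (\<lambda>\<omega>. a \<bullet> X \<omega>). iexp x) = (CLINT x|return borel (a \<bullet> m). iexp x)"
      by simp
    also have "\<dots> = iexp (a \<bullet> m)"
      by (subst integral_return) auto
    finally show ?thesis
      using True by (simp add: integral_distr)
  next
    case False
    define \<sigma> where "\<sigma> = sqrt (a \<bullet> (S *v a))"
    have var: "a \<bullet> (S *v a) \<ge> 0" using assms(2) by (simp add: gaussian_vec_def)
    then have \<sigma>: "\<sigma> > 0" "\<sigma>\<^sup>2 = a \<bullet> (S *v a)" using False by (auto simp: \<sigma>_def)
    have "distributed M lborel (\<lambda>\<omega>. a \<bullet> X \<omega>) (normal_density (a \<bullet> m) \<sigma>)"
      using assms(2) False by (auto simp: gaussian_vec_def \<sigma>_def split: if_splits)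
    then have "distributed M lborel (\<lambda>\<omega>. (a \<bullet> X \<omega> - a \<bullet> m) / \<sigma>) std_normal_density"
      by (simp only: normal_standard_normal_convert[OF \<sigma>(1)])
    then have "distr M lborel (\<lambda>\<omega>. (a \<bullet> X \<omega> - a \<bullet> m) / \<sigma>) = std_normal_distribution"
      by (simp add: distributed_def)
    then have "(CLINT x|distr M lborel (\<lambda>\<omega>. (a \<bullet> X \<omega> - a \<bullet> m) / \<sigma>). iexp (\<sigma> * x)) =
        of_real (exp (- \<sigma>\<^sup>2 / 2))"
      using fun_cong[OF char_std_normal_distribution, of \<sigma>] by (simp add: char_def)
    then have *: "(CLINT \<omega>|M. iexp (\<sigma> * ((a \<bullet> X \<omega> - a \<bullet> m) / \<sigma>))) = of_real (exp (- \<sigma>\<^sup>2 / 2))"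
      by (subst (asm) integral_distr) auto
    have "iexp (a \<bullet> X \<omega>) = iexp (a \<bullet> m) * iexp (\<sigma> * ((a \<bullet> X \<omega> - a \<bullet> m) / \<sigma>))" for \<omega>
    proof -
      have "\<sigma> * ((a \<bullet> X \<omega> - a \<bullet> m) / \<sigma>) = a \<bullet> X \<omega> - a \<bullet> m" using \<sigma>(1) by simp
      then show ?thesis by (simp only: exp_add[symmetric] distrib_left[symmetric] of_real_add[symmetric]) simp
    qed
    then have "(CLINT \<omega>|M. iexp (a \<bullet> X \<omega>)) =
        iexp (a \<bullet> m) * (CLINT \<omega>|M. iexp (\<sigma> * ((a \<bullet> X \<omega> - a \<bullet> m) / \<sigma>)))"
      by (simp only: integral_mult_right_zero)
    then show ?thesis using * \<sigma>(2) by simp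
  qed
qed

lemma gauss_char_distr_eq:
  assumes "prob_space M" "prob_space N" "gauss_char M X m q" "gauss_char N Y m q"
  shows "distr M borel X = distr N borel Y"
proof -
  have [measurable]: "X \<in> borel_measurable M" "Y \<in> borel_measurable N"
    using assms by (auto simp: gauss_char_def)
  show ?thesis
  proof (rule prob_measure_eqI_char)
    fix a
    show "(CLINT x|distr M borel X. iexp (a \<bullet> x)) = (CLINT x|distr N borel Y. iexp (a \<bullet> x))"
      using assms(3,4) by (subst (1 2) integral_distr) (auto simp: gauss_char_def)
  qed (auto intro!: prob_space.prob_space_distr assms)
qed

text \<open>The modulus of the characteristic function determines \<open>q\<close>, after which its
  phase determines the mean.\<close>

lemma gauss_char_inject:
  assumes "gauss_char M X m q" "gauss_char N Y m' q'"
    and "distr M borel X = distr N borel Y"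
  shows "m = m'" "q = q'"
proof -
  have [measurable]: "X \<in> borel_measurable M" "Y \<in> borel_measurable N"
    using assms by (auto simp: gauss_char_def)
  have eq: "iexp (a \<bullet> m) * of_real (exp (- q a / 2)) = iexp (a \<bullet> m') * of_real (exp (- q' a / 2))" for a
  proof -
    have "(CLINT \<omega>|M. iexp (a \<bullet> X \<omega>)) = (CLINT x|distr M borel X. iexp (a \<bullet> x))"
      by (subst integral_distr) auto
    also have "\<dots> = (CLINT \<omega>|N. iexp (a \<bullet> Y \<omega>))"
      unfolding assms(3) by (subst integral_distr) auto
    finally show ?thesis using assms(1,2) by (simp add: gauss_char_def)
  qed
  have q: "q a = q' a" for a
    using arg_cong[OF eq[of a], of norm] by (simp add: norm_mult)
  then show "q = q'" by blast
  show "m = m'"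
  proof (rule ccontr)
    assume "m \<noteq> m'"
    then have ne: "(m - m') \<bullet> (m - m') \<noteq> 0" by simp
    \<comment> \<open>Scaled so that the two phases differ by exactly \<open>pi\<close>, where
      \<open>iexp\<close> is -1 rather than 1.\<close>
    define a where "a = (pi / ((m - m') \<bullet> (m - m'))) *\<^sub>R (m - m')"
    have "iexp (a \<bullet> m) = iexp (a \<bullet> m')" using eq[of a] q[of a] by simp
    then have "iexp (a \<bullet> (m - m')) = 1" by (simp add: inner_diff_right right_diff_distrib exp_diff)
    moreover have "a \<bullet> (m - m') = pi" using ne by (simp add: a_def)
    ultimately show False by (simp del: mem_ball)
  qed
qed

lemma measurable_matrix_vector_mult [measurable (raw)]:
  fixes A :: "real^'n^'k"
  assumes "f \<in> borel_measurable M"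
  shows "(\<lambda>x. A *v f x) \<in> borel_measurable M"
  using assms
  by (rule measurable_compose)
    (intro borel_measurable_continuous_onI linear_continuous_on matrix_vector_mul_bounded_linear)

text \<open>The matrix passes to the test vector as its transpose, and the constant \<open>c\<close>
  contributes only a phase.\<close>

lemma gauss_char_affine:
  fixes A :: "real^'n^'k"
  assumes "gauss_char M X m q"
  shows "gauss_char M (\<lambda>\<omega>. c + A *v X \<omega>) (c + A *v m) (\<lambda>a. q (transpose A *v a))"
proof -
  have [measurable]: "X \<in> borel_measurable M" using assms by (simp add: gauss_char_def)
  have dot: "a \<bullet> (A *v x) = (transpose A *v a) \<bullet> x" for a x
    by (simp add: dot_lmul_matrix[symmetric])
  have "iexp (a \<bullet> (c + A *v x)) = iexp (a \<bullet> c) * iexp ((transpose A *v a) \<bullet> x)" for a x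
    by (simp add: inner_add_right dot distrib_left exp_add)
  then show ?thesis
    using assms by (simp add: gauss_char_def)
qed

lemma gauss_char_sum:
  assumes "prob_space M" "finite I" "prob_space.indep_vars M (\<lambda>_. borel) X I"
    and g: "\<And>i. i \<in> I \<Longrightarrow> gauss_char M (X i) (m i) (q i)"
  shows "gauss_char M (\<lambda>\<omega>. \<Sum>i\<in>I. X i \<omega>) (\<Sum>i\<in>I. m i) (\<lambda>a. \<Sum>i\<in>I. q i a)"
  unfolding gauss_char_def
proof (intro conjI allI)
  interpret prob_space M by fact
  have [measurable]: "X i \<in> borel_measurable M" if "i \<in> I" for i
    using g[OF that] by (simp add: gauss_char_def)
  show "(\<lambda>\<omega>. \<Sum>i\<in>I. X i \<omega>) \<in> borel_measurable M" by measurable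
  fix a
  \<comment> \<open>Independence passes to the scalar projections, whose characteristic functions at
    1 are those of the vectors at \<open>a\<close>.\<close>
  have "indep_vars (\<lambda>_. borel) (\<lambda>i \<omega>. a \<bullet> X i \<omega>) I"
    by (rule indep_vars_compose2[OF assms(3)]) auto
  from char_distr_sum[OF this, of 1]
  have "char (distr M borel (\<lambda>\<omega>. \<Sum>i\<in>I. a \<bullet> X i \<omega>)) 1 =
      (\<Prod>i\<in>I. char (distr M borel (\<lambda>\<omega>. a \<bullet> X i \<omega>)) 1)" .
  also have "char (distr M borel (\<lambda>\<omega>. \<Sum>i\<in>I. a \<bullet> X i \<omega>)) 1 =
      (CLINT \<omega>|M. iexp (a \<bullet> (\<Sum>i\<in>I. X i \<omega>)))"
    unfolding char_def by (subst integral_distr) (auto simp: inner_sum_right)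
  also have "(\<Prod>i\<in>I. char (distr M borel (\<lambda>\<omega>. a \<bullet> X i \<omega>)) 1) =
      (\<Prod>i\<in>I. iexp (a \<bullet> m i) * of_real (exp (- q i a / 2)))"
  proof (rule prod.cong[OF refl])
    fix i assume i: "i \<in> I"
    then have [measurable]: "X i \<in> borel_measurable M" by measurable
    show "char (distr M borel (\<lambda>\<omega>. a \<bullet> X i \<omega>)) 1 = iexp (a \<bullet> m i) * of_real (exp (- q i a / 2))"
      unfolding char_def using g[OF i] by (subst integral_distr) (auto simp: gauss_char_def)
  qed
  also have "\<dots> = iexp (a \<bullet> (\<Sum>i\<in>I. m i)) * of_real (exp (- (\<Sum>i\<in>I. q i a) / 2))"
    using assms(2)
    by (simp add: prod.distrib inner_sum_right sum_distrib_left exp_sum sum_negf[symmetric]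
        sum_divide_distrib)
  finally show "(CLINT \<omega>|M. iexp (a \<bullet> (\<Sum>i\<in>I. X i \<omega>))) =
      iexp (a \<bullet> (\<Sum>i\<in>I. m i)) * of_real (exp (- (\<Sum>i\<in>I. q i a) / 2))" .
qed

section \<open>Supports of random vectors, in particular of Gaussian ones\<close>

lemma suppD: "z \<in> supp M X \<Longrightarrow> \<rho> > 0 \<Longrightarrow> 0 < measure M {\<omega> \<in> space M. X \<omega> \<in> ball z \<rho>}"
  by (simp add: supp_def)

text \<open>Every point off the support is the centre of a null ball, and by the Lindelof property
  countably many null balls already cover all of these points.\<close>

lemma AE_in_supp:
  fixes X :: "'s \<Rightarrow> 'a::euclidean_space"
  assumes "prob_space M" and [measurable]: "X \<in> borel_measurable M"
  shows "AE \<omega> in M. X \<omega> \<in> supp M X"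
proof -
  interpret prob_space M by fact
  define F where "F = {ball z \<rho> | z \<rho>. measure M {\<omega> \<in> space M. X \<omega> \<in> ball z \<rho>} = 0}"
  obtain F' where F': "F' \<subseteq> F" "countable F'" "\<Union>F' = \<Union>F"
    using Lindelof[of F] by (auto simp: F_def)
  have "AE \<omega> in M. \<forall>B\<in>F'. X \<omega> \<notin> B"
  proof (subst AE_ball_countable[OF F'(2)], intro ballI)
    fix B assume "B \<in> F'"
    then obtain z \<rho> where B: "B = ball z \<rho>" "measure M {\<omega> \<in> space M. X \<omega> \<in> ball z \<rho>} = 0"
      using F'(1) by (auto simp: F_def)
    show "AE \<omega> in M. X \<omega> \<notin> B"
      by (rule AE_I[where N="{\<omega> \<in> space M. X \<omega> \<in> ball z \<rho>}"])
        (use B in \<open>auto simp: emeasure_eq_measure\<close>)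
  qed
  then show ?thesis
  proof (rule eventually_mono)
    fix \<omega> assume "\<forall>B\<in>F'. X \<omega> \<notin> B"
    then have "X \<omega> \<notin> \<Union>F" using F'(3) by blast
    then have "measure M {\<omega>' \<in> space M. X \<omega>' \<in> ball (X \<omega>) \<rho>} \<noteq> 0" if "\<rho> > 0" for \<rho>
      using that centre_in_ball[of "X \<omega>" \<rho>] unfolding F_def by blast
    then show "X \<omega> \<in> supp M X"
      by (auto simp: supp_def zero_less_measure_iff order_less_le)
  qed
qed

lemma supp_subset_closed:
  fixes X :: "'s \<Rightarrow> 'a::euclidean_space"
  assumes "closed C" "\<And>\<omega>. X \<omega> \<in> C"
  shows "supp M X \<subseteq> C"
proof
  fix z assume z: "z \<in> supp M X"
  show "z \<in> C"
  proof (rule ccontr)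
    assume "z \<notin> C"
    then obtain \<rho> where "\<rho> > 0" "ball z \<rho> \<subseteq> - C"
      using assms(1) by (metis ComplI open_Compl open_contains_ball)
    then have "{\<omega> \<in> space M. X \<omega> \<in> ball z \<rho>} = {}" using assms(2) by auto
    with suppD[OF z \<open>\<rho> > 0\<close>] show False by (simp del: mem_ball)
  qed
qed

text \<open>Half of the radius absorbs the distance to a nearby support point. Closedness makes the
  support a Borel set.\<close>

lemma closed_supp:
  fixes X :: "'s \<Rightarrow> 'a::euclidean_space"
  assumes "prob_space M" and [measurable]: "X \<in> borel_measurable M"
  shows "closed (supp M X)"
  unfolding closed_limpt islimpt_approachable
proof (intro allI impI)
  interpret prob_space M by fact
  fix x assume x: "\<forall>e>0. \<exists>x'\<in>supp M X. x' \<noteq> x \<and> dist x' x < e"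
  show "x \<in> supp M X" unfolding supp_def
  proof (intro CollectI allI impI)
    fix \<rho> :: real assume "\<rho> > 0"
    then obtain x' where x': "x' \<in> supp M X" "dist x' x < \<rho> / 2"
      using x by (meson half_gt_zero)
    have "0 < measure M {\<omega> \<in> space M. X \<omega> \<in> ball x' (\<rho> / 2)}"
      using suppD[OF x'(1), of "\<rho> / 2"] \<open>\<rho> > 0\<close> by simp
    also have "\<dots> \<le> measure M {\<omega> \<in> space M. X \<omega> \<in> ball x \<rho>}"
    proof (rule finite_measure_mono)
      have "ball x' (\<rho> / 2) \<subseteq> ball x \<rho>"
        using x'(2) by (simp add: ball_subset_ball_iff)
      then show "{\<omega> \<in> space M. X \<omega> \<in> ball x' (\<rho> / 2)} \<subseteq> {\<omega> \<in> space M. X \<omega> \<in> ball x \<rho>}" by blast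
    qed simp
    finally show "measure M {\<omega> \<in> space M. X \<omega> \<in> ball x \<rho>} > 0" .
  qed
qed

text \<open>A centred Gaussian law is invariant under \<open>(x, y) \<mapsto> c x + s y\<close> with \<open>c\<^sup>2 + s\<^sup>2 = 1\<close> applied
  to two independent copies; hence its support is closed under such combinations, which makes it
  a subspace.\<close>

lemma gauss_char_supp_rotation:
  fixes X :: "'s \<Rightarrow> 'a::euclidean_space"
  assumes "prob_space M" and g: "gauss_char M X 0 q"
    and hom: "\<And>c a. q (c *\<^sub>R a) = c\<^sup>2 * q a"
    and cs: "c\<^sup>2 + s\<^sup>2 = 1" and xy: "x \<in> supp M X" "y \<in> supp M X"
  shows "c *\<^sub>R x + s *\<^sub>R y \<in> supp M X"
proof -
  interpret M: prob_space M by fact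
  have [measurable]: "X \<in> borel_measurable M" using g by (simp add: gauss_char_def)
  define P where "P = distr M borel X"
  interpret P: prob_space P unfolding P_def by (rule M.prob_space_distr) measurable
  interpret PP: pair_prob_space P P ..
  have setsP [measurable_cong]: "sets P = sets borel" by (simp add: P_def)
  have spP: "space P = UNIV" by (simp add: P_def)
  have charP: "(CLINT x|P. iexp (a \<bullet> x)) = of_real (exp (- q a / 2))" for a
    unfolding P_def using g by (subst integral_distr) (auto simp: gauss_char_def)
  let ?h = "\<lambda>(x, y). c *\<^sub>R x + s *\<^sub>R y"
  have [measurable]: "?h \<in> borel_measurable (P \<Otimes>\<^sub>M P)" by measurable
  \<comment> \<open>By Fubini the characteristic function splits into its values at
    \<open>c *\<^sub>R a\<close> and \<open>s *\<^sub>R a\<close>; \<open>hom\<close> and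
    \<open>cs\<close> recombine the exponents to \<open>q a\<close>.\<close>
  have "distr (P \<Otimes>\<^sub>M P) borel ?h = P"
  proof (rule prob_measure_eqI_char)
    show "prob_space (distr (P \<Otimes>\<^sub>M P) borel ?h)" by (rule PP.prob_space_distr) measurable
    show "prob_space P" by (rule P.prob_space_axioms)
    fix a
    have "(CLINT z|distr (P \<Otimes>\<^sub>M P) borel ?h. iexp (a \<bullet> z)) = (CLINT z|P \<Otimes>\<^sub>M P. iexp (a \<bullet> ?h z))"
      by (subst integral_distr) auto
    also have "\<dots> = (CLINT x|P. CLINT y|P. iexp (a \<bullet> (c *\<^sub>R x + s *\<^sub>R y)))"
    proof -
      have "integrable (P \<Otimes>\<^sub>M P) (\<lambda>z. iexp (a \<bullet> ?h z))"
        by (rule PP.integrable_iexp) auto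
      from PP.integral_fst'[OF this] show ?thesis by simp
    qed
    also have "\<dots> = (CLINT x|P. CLINT y|P. iexp ((c *\<^sub>R a) \<bullet> x) * iexp ((s *\<^sub>R a) \<bullet> y))"
      by (simp add: inner_add_right distrib_left exp_add)
    also have "\<dots> = (CLINT x|P. iexp ((c *\<^sub>R a) \<bullet> x)) * (CLINT y|P. iexp ((s *\<^sub>R a) \<bullet> y))"
      by (simp only: integral_mult_right_zero integral_mult_left_zero)
    also have "\<dots> = of_real (exp (- (c\<^sup>2 * q a) / 2)) * of_real (exp (- (s\<^sup>2 * q a) / 2))"
      by (simp only: charP hom)
    also have "\<dots> = of_real (exp (- ((c\<^sup>2 + s\<^sup>2) * q a) / 2))"
      by (simp only: of_real_mult[symmetric] exp_add[symmetric]) (simp add: field_simps)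
    finally show "(CLINT z|distr (P \<Otimes>\<^sub>M P) borel ?h. iexp (a \<bullet> z)) = (CLINT x|P. iexp (a \<bullet> x))"
      by (simp add: charP cs)
  qed (simp_all add: setsP)
  then have inv: "measure P B = measure (P \<Otimes>\<^sub>M P) (?h -` B \<inter> space (P \<Otimes>\<^sub>M P))" if "B \<in> sets borel" for B
    using that measure_distr[of ?h "P \<Otimes>\<^sub>M P" borel B] by simp
  have mP: "measure P B = measure M {\<omega> \<in> space M. X \<omega> \<in> B}" if "B \<in> sets borel" for B
    unfolding P_def using that by (subst measure_distr) (auto intro!: arg_cong[where f="measure M"])
  have "\<bar>c\<bar> \<le> 1" "\<bar>s\<bar> \<le> 1"
    using cs zero_le_power2[of c] zero_le_power2[of s] unfolding abs_square_le_1[symmetric]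
    by linarith+
  show ?thesis unfolding supp_def
  proof (intro CollectI allI impI)
    fix \<rho> :: real assume "\<rho> > 0"
    \<comment> \<open>Since \<open>c\<close> and \<open>s\<close> have modulus at most 1,
      \<open>?h\<close> maps the product of the two half-radius balls into the target ball, and this
      product has positive mass.\<close>
    have "0 < measure P (ball x (\<rho> / 2)) * measure P (ball y (\<rho> / 2))"
      using suppD[OF xy(1), of "\<rho> / 2"] suppD[OF xy(2), of "\<rho> / 2"] \<open>\<rho> > 0\<close> by (simp add: mP del: mem_ball)
    also have "\<dots> = measure (P \<Otimes>\<^sub>M P) (ball x (\<rho> / 2) \<times> ball y (\<rho> / 2))"
      unfolding measure_def by (subst P.emeasure_pair_measure_Times) (auto simp: setsP enn2real_mult)
    also have "\<dots> \<le> measure (P \<Otimes>\<^sub>M P) (?h -` ball (c *\<^sub>R x + s *\<^sub>R y) \<rho> \<inter> space (P \<Otimes>\<^sub>M P))"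
    proof (rule PP.finite_measure_mono)
      show "ball x (\<rho> / 2) \<times> ball y (\<rho> / 2) \<subseteq> ?h -` ball (c *\<^sub>R x + s *\<^sub>R y) \<rho> \<inter> space (P \<Otimes>\<^sub>M P)"
      proof (clarsimp simp: space_pair_measure spP)
        fix x' y' assume d: "dist x x' * 2 < \<rho>" "dist y y' * 2 < \<rho>"
        have "dist (c *\<^sub>R x + s *\<^sub>R y) (c *\<^sub>R x' + s *\<^sub>R y') = norm (c *\<^sub>R (x - x') + s *\<^sub>R (y - y'))"
          by (simp add: dist_norm algebra_simps)
        also have "\<dots> \<le> \<bar>c\<bar> * dist x x' + \<bar>s\<bar> * dist y y'"
          by (metis norm_triangle_ineq norm_scaleR dist_norm)
        also have "\<dots> \<le> 1 * dist x x' + 1 * dist y y'"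
          using \<open>\<bar>c\<bar> \<le> 1\<close> \<open>\<bar>s\<bar> \<le> 1\<close> by (intro add_mono mult_right_mono) auto
        also have "\<dots> < \<rho>" using d by simp
        finally show "dist (c *\<^sub>R x + s *\<^sub>R y) (c *\<^sub>R x' + s *\<^sub>R y') < \<rho>" .
      qed
    qed measurable
    also have "\<dots> = measure P (ball (c *\<^sub>R x + s *\<^sub>R y) \<rho>)" by (rule inv[symmetric]) simp
    finally show "0 < measure M {\<omega> \<in> space M. X \<omega> \<in> ball (c *\<^sub>R x + s *\<^sub>R y) \<rho>}"
      by (simp add: mP)
  qed
qed

text \<open>Rotating a point with itself gives its multiples by \<open>k\<close> with
  \<open>k\<^sup>2 \<le> 2\<close>. Equal rotation weights applied to points enlarged by
  \<open>sqrt 2\<close> give sums, and repeated addition reaches the remaining multiples.\<close>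

lemma gauss_char_supp_subspace:
  fixes X :: "'s \<Rightarrow> 'a::euclidean_space"
  assumes "prob_space M" and g: "gauss_char M X 0 q"
    and hom: "\<And>c a. q (c *\<^sub>R a) = c\<^sup>2 * q a"
  shows "subspace (supp M X)"
proof -
  interpret M: prob_space M by fact
  note rot = gauss_char_supp_rotation[OF assms]
  have X: "X \<in> borel_measurable M" using g by (simp add: gauss_char_def)
  have small: "k *\<^sub>R z \<in> supp M X" if z: "z \<in> supp M X" and k: "k\<^sup>2 \<le> 2" for k z
  proof -
    \<comment> \<open>With \<open>k\<^sup>2 + d\<^sup>2 = 2\<close> the weights
      \<open>(k + d) / 2\<close> and \<open>(k - d) / 2\<close> have squares summing to 1 and
      themselves sum to \<open>k\<close>.\<close>
    define d where "d = sqrt (2 - k\<^sup>2)"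
    have d: "d\<^sup>2 = 2 - k\<^sup>2" using k by (simp add: d_def)
    have "((k + d) / 2)\<^sup>2 + ((k - d) / 2)\<^sup>2 = (k\<^sup>2 + d\<^sup>2) / 2"
      by (simp add: power2_eq_square field_simps)
    then have "((k + d) / 2)\<^sup>2 + ((k - d) / 2)\<^sup>2 = 1" by (simp add: d)
    from rot[OF this z z] show ?thesis
      by (simp add: scaleR_add_left[symmetric] field_simps)
  qed
  have add: "x + y \<in> supp M X" if "x \<in> supp M X" "y \<in> supp M X" for x y
  proof -
    have "(1 / sqrt 2) *\<^sub>R (sqrt 2 *\<^sub>R x) + (1 / sqrt 2) *\<^sub>R (sqrt 2 *\<^sub>R y) \<in> supp M X"
      by (intro rot small that) (auto simp: power_divide)
    then show ?thesis by simp
  qed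
  have zero: "0 \<in> supp M X"
  proof -
    have "supp M X \<noteq> {}" using AE_in_supp[OF assms(1) X] M.AE_False by auto
    then obtain z where "z \<in> supp M X" by auto
    from small[OF this, of 0] show ?thesis by simp
  qed
  have nat: "real n *\<^sub>R z \<in> supp M X" if "z \<in> supp M X" for n z
    by (induction n) (auto simp: zero that algebra_simps intro: add)
  have "k *\<^sub>R z \<in> supp M X" if z: "z \<in> supp M X" for k z
  proof -
    obtain n :: nat where n: "\<bar>k\<bar> \<le> real n" using real_arch_simple by blast
    show ?thesis
    proof (cases "n = 0")
      case True
      then show ?thesis using n zero by simp
    next
      case False
      then have "\<bar>k / real n\<bar> \<le> 1" using n by (simp add: abs_divide)
      then have "(k / real n)\<^sup>2 \<le> 2" unfolding abs_square_le_1[symmetric] by linarith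
      from nat[OF small[OF z this], of n] show ?thesis using False by simp
    qed
  qed
  then show ?thesis by (auto simp: subspace_def zero add)
qed

text \<open>The support of the centred law is a subspace. The part of \<open>v\<close> orthogonal to
  it pairs to zero with the centred variable almost surely, so \<open>q\<close> vanishes there, and
  the assumption on \<open>v\<close> forces that part to be zero.\<close>

lemma gauss_char_supp_shift:
  fixes X :: "'s \<Rightarrow> real^'n"
  assumes "prob_space M" and g: "gauss_char M X m q"
    and hom: "\<And>c a. q (c *\<^sub>R a) = c\<^sup>2 * q a"
    and v: "\<And>a. q a = 0 \<Longrightarrow> a \<bullet> v = 0"
    and z: "z \<in> supp M X"
  shows "z + v \<in> supp M X"
proof -
  interpret M: prob_space M by fact
  have [measurable]: "X \<in> borel_measurable M" using g by (simp add: gauss_char_def)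
  define X' where "X' \<omega> = X \<omega> - m" for \<omega>
  have g': "gauss_char M X' 0 q"
    using gauss_char_affine[OF g, of "- m" "mat 1"] by (simp add: X'_def[abs_def])
  have supp: "x \<in> supp M X \<longleftrightarrow> x - m \<in> supp M X'" for x
    by (simp add: supp_def X'_def dist_norm algebra_simps)
  define S where "S = supp M X'"
  have S: "subspace S" unfolding S_def by (rule gauss_char_supp_subspace[OF assms(1) g' hom])
  have "v \<in> S"
  proof -
    obtain s a where sa: "s \<in> span S" "\<And>w. w \<in> span S \<Longrightarrow> orthogonal a w" "v = s + a"
      using orthogonal_subspace_decomp_exists[of S v] by metis
    have "AE \<omega> in M. X' \<omega> \<in> S"
      unfolding S_def by (rule AE_in_supp[OF assms(1)]) (simp add: X'_def[abs_def])
    then have "AE \<omega> in M. iexp (a \<bullet> X' \<omega>) = 1"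
      by (rule eventually_mono) (use sa(2) span_superset in \<open>fastforce simp: orthogonal_def\<close>)
    then have "(CLINT \<omega>|M. iexp (a \<bullet> X' \<omega>)) = (CLINT \<omega>|M. 1)"
      by (intro integral_cong_AE) (auto simp: X'_def)
    then have "of_real (exp (- q a / 2)) = (1 :: complex)"
      using g' by (simp add: gauss_char_def M.prob_space)
    then have "q a = 0" by (simp only: of_real_eq_1_iff) simp
    then have "a \<bullet> v = 0" by (rule v)
    moreover have "a \<bullet> s = 0" using sa by (auto simp: orthogonal_def)
    ultimately have "a = 0" using sa(3) by (simp add: inner_add_right)
    then show ?thesis using sa S by (simp add: span_eq_iff[THEN iffD2])
  qed
  then have "(z - m) + v \<in> S"
    using S z supp S_def by (metis subspace_add)
  then show ?thesis by (simp add: supp S_def algebra_simps)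
qed

section \<open>Reachable subspaces and state trajectories\<close>

text \<open>Freeing the number of blocks from the dimension matches the state at an arbitrary time
  \<open>t\<close> and allows induction on \<open>t\<close>.\<close>

definition reach_upto :: "real^'n^'n \<Rightarrow> real^'l^'n \<Rightarrow> nat \<Rightarrow> (real^'n) set" where
  "reach_upto A G t = {(\<Sum>k<t. matpow A k ** G *v v k) | v :: nat \<Rightarrow> real^'l. True}"

lemma reach_uptoI: "(\<Sum>k<t. matpow A k ** G *v v k) \<in> reach_upto A G t"
  by (auto simp: reach_upto_def)

lemma reach_image_eq_reach_upto: "reach_image A (G :: real^'l^'n) = reach_upto A G CARD('n)"
  by (simp add: reach_image_def reach_upto_def)

lemma subspace_reach_upto: "subspace (reach_upto A G t)"
  unfolding subspace_def
proof (intro conjI ballI allI)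
  show "0 \<in> reach_upto A G t"
    using reach_uptoI[of A G "\<lambda>_. 0" t] by simp
next
  fix x y assume "x \<in> reach_upto A G t" "y \<in> reach_upto A G t"
  then obtain v v' where "x = (\<Sum>k<t. matpow A k ** G *v v k)" "y = (\<Sum>k<t. matpow A k ** G *v v' k)"
    by (auto simp: reach_upto_def)
  then have "x + y = (\<Sum>k<t. matpow A k ** G *v (v k + v' k))"
    by (simp add: sum.distrib matrix_vector_right_distrib)
  then show "x + y \<in> reach_upto A G t" using reach_uptoI[of A G "\<lambda>k. v k + v' k" t] by simp
next
  fix c x assume "x \<in> reach_upto A G t"
  then obtain v where "x = (\<Sum>k<t. matpow A k ** G *v v k)"
    by (auto simp: reach_upto_def)
  then have "c *\<^sub>R x = (\<Sum>k<t. matpow A k ** G *v (c *\<^sub>R v k))"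
    by (simp add: scaleR_right.sum matrix_vector_mult_scaleR)
  then show "c *\<^sub>R x \<in> reach_upto A G t" using reach_uptoI[of A G "\<lambda>k. c *\<^sub>R v k" t] by simp
qed

lemma mat_vec_sum: "(A :: real^'n^'k) *v (\<Sum>i\<in>I. f i) = (\<Sum>i\<in>I. A *v f i)"
  by (rule linear_sum) simp

text \<open>Splitting off the term \<open>k = 0\<close> and pulling \<open>A\<close> out of the rest
  shows that each set is a function of its predecessor, which makes stabilisation permanent.\<close>

lemma reach_upto_Suc: "reach_upto A G (Suc t) = {G *v v + A *v x | v x. x \<in> reach_upto A G t}"
proof -
  have eq: "(\<Sum>k<Suc t. matpow A k ** G *v v k) = G *v v 0 + A *v (\<Sum>k<t. matpow A k ** G *v v (Suc k))" for v
    unfolding sum.lessThan_Suc_shift mat_vec_sum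
    by (simp add: matrix_vector_mul_assoc matrix_mul_assoc)
  show ?thesis
  proof (intro set_eqI iffI)
    fix y assume "y \<in> reach_upto A G (Suc t)"
    then obtain v where "y = (\<Sum>k<Suc t. matpow A k ** G *v v k)" by (auto simp: reach_upto_def)
    then show "y \<in> {G *v v + A *v x | v x. x \<in> reach_upto A G t}"
      unfolding eq using reach_uptoI[of A G "\<lambda>k. v (Suc k)" t] by blast
  next
    fix y assume "y \<in> {G *v v + A *v x | v x. x \<in> reach_upto A G t}"
    then obtain v0 v where "y = G *v v0 + A *v (\<Sum>k<t. matpow A k ** G *v v k)"
      by (auto simp: reach_upto_def)
    \<comment> \<open>\<open>case_nat v0 v\<close> puts \<open>v0\<close> in front of the sequence
      \<open>v\<close>.\<close>
    then have "y = (\<Sum>k<Suc t. matpow A k ** G *v case_nat v0 v k)" unfolding eq by simp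
    then show "y \<in> reach_upto A G (Suc t)" by (simp only: reach_uptoI)
  qed
qed

lemma reach_upto_subset_Suc: "reach_upto A G t \<subseteq> reach_upto A G (Suc t)"
proof
  fix y assume "y \<in> reach_upto A G t"
  then obtain v where "y = (\<Sum>k<t. matpow A k ** G *v v k)" by (auto simp: reach_upto_def)
  then have "y = (\<Sum>k<Suc t. matpow A k ** G *v (if k < t then v k else 0))" by simp
  then show "y \<in> reach_upto A G (Suc t)" by (simp only: reach_uptoI)
qed

lemma reach_upto_mono: "s \<le> t \<Longrightarrow> reach_upto A G s \<subseteq> reach_upto A G t"
  by (rule lift_Suc_mono_le[of "reach_upto A G", OF reach_upto_subset_Suc])

lemma reach_upto_stable:
  assumes "reach_upto A G (Suc k) = reach_upto A G k"
  shows "reach_upto A G (k + j) = reach_upto A G k"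
proof (induction j)
  case (Suc j)
  have "reach_upto A G (Suc (k + j)) = reach_upto A G (Suc k)"
    by (simp only: reach_upto_Suc[of A G "k + j"] reach_upto_Suc[of A G k] Suc.IH)
  then show ?case using assms by simp
qed simp

text \<open>Dimension count in place of the Cayley--Hamilton theorem.\<close>

lemma reach_upto_subset_reach_image:
  fixes A :: "real^'n^'n"
  shows "reach_upto A G t \<subseteq> reach_image A G"
proof -
  have "\<exists>k\<le>CARD('n). reach_upto A G (Suc k) = reach_upto A G k"
  proof (rule ccontr)
    assume no: "\<not> ?thesis"
    \<comment> \<open>Without a stationary step up to \<open>CARD('n)\<close> the dimension grows
      each time and ends up larger than that of the whole space.\<close>
    have "k \<le> Suc CARD('n) \<Longrightarrow> k \<le> dim (reach_upto A G k)" for k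
    proof (induction k)
      case (Suc k)
      have "dim (reach_upto A G k) < dim (reach_upto A G (Suc k))"
        using subspace_dim_equal[OF subspace_reach_upto subspace_reach_upto reach_upto_subset_Suc, of A G k]
          no Suc.prems by (metis Suc_le_mono not_le)
      then show ?case using Suc by simp
    qed simp
    from this[of "Suc CARD('n)"] dim_subset_UNIV[of "reach_upto A G (Suc CARD('n))"]
    show False by simp
  qed
  then obtain k where k: "k \<le> CARD('n)" "reach_upto A G (Suc k) = reach_upto A G k" by blast
  have "reach_upto A G t \<subseteq> reach_upto A G (k + t)" by (rule reach_upto_mono) simp
  also have "\<dots> = reach_upto A G k" by (rule reach_upto_stable[OF k(2)])
  also have "\<dots> \<subseteq> reach_image A G"
    unfolding reach_image_eq_reach_upto by (rule reach_upto_mono[OF k(1)])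
  finally show ?thesis .
qed

section \<open>State trajectories and their Gaussian laws\<close>

lemma state_0: "state A B G w x0 u 0 \<omega> = x0"
  by (simp add: state_def)

lemma state_Suc:
  "state A B G w x0 u (Suc t) \<omega> = A *v state A B G w x0 u t \<omega> + (B *v u t + G *v w t \<omega>)"
proof -
  have "(\<Sum>\<tau><t. matpow A (t - \<tau>) *v (B *v u \<tau> + G *v w \<tau> \<omega>)) =
      A *v (\<Sum>\<tau><t. matpow A (t - 1 - \<tau>) *v (B *v u \<tau> + G *v w \<tau> \<omega>))"
    unfolding mat_vec_sum
  proof (rule sum.cong[OF refl])
    fix \<tau> assume "\<tau> \<in> {..<t}"
    \<comment> \<open>For \<open>\<tau> < t\<close> truncated subtraction is exact, so one factor
      \<open>A\<close> can be split off.\<close>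
    then have "t - \<tau> = Suc (t - 1 - \<tau>)" by auto
    then show "matpow A (t - \<tau>) *v (B *v u \<tau> + G *v w \<tau> \<omega>) =
        A *v (matpow A (t - 1 - \<tau>) *v (B *v u \<tau> + G *v w \<tau> \<omega>))"
      by (simp add: matrix_vector_mul_assoc)
  qed
  then show ?thesis
    by (simp add: state_def matrix_vector_right_distrib matrix_vector_mul_assoc)
qed

text \<open>The deterministic part is itself a state, with zero noise on the one-point sample space;
  hence the argument \<open>()\<close>.\<close>

lemma state_eq_drift_plus_noise:
  "state A B G w x0 u t \<omega> = state A B G (\<lambda>_ _. 0) x0 u t ()
     + (\<Sum>\<tau><t. matpow A (t - 1 - \<tau>) ** G *v w \<tau> \<omega>)"
  by (simp add: state_def matrix_vector_right_distrib sum.distrib matrix_vector_mul_assoc)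

text \<open>Reversing time turns the noise sum into an element of \<open>reach_upto A G t\<close>.
  This holds for every outcome, not merely almost surely.\<close>

lemma state_in_reach_image:
  "state A B G w x0 u t \<omega> - state A B G (\<lambda>_ _. 0) x0 u t () \<in> reach_image A G"
proof -
  have "(\<Sum>\<tau><t. matpow A (t - 1 - \<tau>) ** G *v w \<tau> \<omega>) = (\<Sum>\<tau><t. matpow A \<tau> ** G *v w (t - 1 - \<tau>) \<omega>)"
    by (rule sum.reindex_bij_witness[where i="\<lambda>\<tau>. t - 1 - \<tau>" and j="\<lambda>\<tau>. t - 1 - \<tau>"]) auto
  then have "state A B G w x0 u t \<omega> - state A B G (\<lambda>_ _. 0) x0 u t () =
      (\<Sum>\<tau><t. matpow A \<tau> ** G *v w (t - 1 - \<tau>) \<omega>)"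
    using state_eq_drift_plus_noise[of A B G w x0 u t \<omega>] by simp
  then show ?thesis
    using reach_uptoI[of A G "\<lambda>\<tau>. w (t - 1 - \<tau>) \<omega>" t] reach_upto_subset_reach_image[of A G t]
    by (simp only: subsetD)
qed

lemma norm_mat_1_inner: "a \<bullet> ((mat 1 :: real^'n^'n) *v a) = (norm a)\<^sup>2"
  by (simp add: power2_norm_eq_inner)

text \<open>The state is a constant plus a sum of independent linear images of the noise; its mean
  is the trajectory with the noise frozen at \<open>mu\<close>.\<close>

lemma gauss_char_state:
  fixes A :: "real^'n^'n" and G :: "real^'l^'n"
  assumes nm: "noise_model M w mu nu Psi"
  shows "gauss_char M (state A B G w x0 u t) (state A B G (\<lambda>_ _. mu) x0 u t ())
    (\<lambda>a. \<Sum>\<tau><t. (norm (transpose (matpow A (t - 1 - \<tau>) ** G) *v a))\<^sup>2)"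
proof -
  interpret prob_space M using nm by (simp add: noise_model_def)
  let ?H = "\<lambda>\<tau>. matpow A (t - 1 - \<tau>) ** G"
  have w: "gauss_char M (w \<tau>) mu (\<lambda>a. (norm a)\<^sup>2)" for \<tau>
    using gauss_char_gaussian_vec[OF prob_space_axioms, of "w \<tau>" mu "mat 1"] nm
    by (simp add: noise_model_def norm_mat_1_inner del: matrix_vector_mul_lid)
  have iv: "indep_vars (\<lambda>_. borel) (\<lambda>t \<omega>. (w t \<omega>, nu t \<omega>)) UNIV"
    using nm by (simp add: noise_model_def)
  \<comment> \<open>Independence over time is given for the pairs of \<open>w\<close> and
    \<open>nu\<close>; the projection \<open>fst\<close> passes it to \<open>w\<close>
    alone.\<close>
  have "indep_vars (\<lambda>_. borel) (\<lambda>\<tau> \<omega>. ?H \<tau> *v fst (w \<tau> \<omega>, nu \<tau> \<omega>)) {..<t}"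
    by (rule indep_vars_compose2[OF indep_vars_subset[OF iv subset_UNIV]])
      (intro measurable_matrix_vector_mult borel_measurable_continuous_onI continuous_intros)
  then have ind: "indep_vars (\<lambda>_. borel) (\<lambda>\<tau> \<omega>. ?H \<tau> *v w \<tau> \<omega>) {..<t}" by simp
  have "gauss_char M (\<lambda>\<omega>. ?H \<tau> *v w \<tau> \<omega>) (?H \<tau> *v mu) (\<lambda>a. (norm (transpose (?H \<tau>) *v a))\<^sup>2)" for \<tau>
    using gauss_char_affine[OF w[of \<tau>], of 0 "?H \<tau>"] by simp
  from gauss_char_sum[OF prob_space_axioms _ ind this]
  have "gauss_char M (\<lambda>\<omega>. \<Sum>\<tau><t. ?H \<tau> *v w \<tau> \<omega>) (\<Sum>\<tau><t. ?H \<tau> *v mu)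
      (\<lambda>a. \<Sum>\<tau><t. (norm (transpose (?H \<tau>) *v a))\<^sup>2)" by simp
  from gauss_char_affine[OF this, of "state A B G (\<lambda>_ _. 0) x0 u t ()" "mat 1"]
  show ?thesis
    unfolding state_eq_drift_plus_noise[of A B G w x0 u t, abs_def]
      state_eq_drift_plus_noise[of A B G "\<lambda>_ _. mu" x0 u t "()"]
    by (simp add: transpose_mat)
qed

section \<open>Quotient dynamics and bisimulation\<close>

lemma noise_model_measurable:
  assumes "noise_model M w mu nu Psi"
  shows "w t \<in> borel_measurable M" "nu t \<in> borel_measurable M"
  using assms by (auto simp: noise_model_def gaussian_vec_def)

text \<open>Independence over time makes the law of the whole driving process an infinite product,
  and at each time the law of the pair is itself a product. Only the one-time marginals then remain
  to be compared.\<close>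

lemma noise_model_image_law:
  fixes H :: "real^'l^'r" and w :: "nat \<Rightarrow> 's \<Rightarrow> real^'l" and nu :: "nat \<Rightarrow> 's \<Rightarrow> real^'p"
  assumes nm: "noise_model M w mu nu Psi"
  shows "distr M (PiM UNIV (\<lambda>_. borel)) (\<lambda>\<omega> t. (H *v w t \<omega>, nu t \<omega>)) =
    PiM UNIV (\<lambda>t. distr M borel (\<lambda>\<omega>. H *v w t \<omega>) \<Otimes>\<^sub>M distr M borel (nu t))"
proof -
  interpret prob_space M using nm by (simp add: noise_model_def)
  have [measurable]: "w t \<in> borel_measurable M" "nu t \<in> borel_measurable M" for t
    using noise_model_measurable[OF nm] by auto
  have iv: "indep_vars (\<lambda>_. borel) (\<lambda>t \<omega>. (w t \<omega>, nu t \<omega>)) UNIV"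
    using nm by (simp add: noise_model_def)
  have hm [measurable]: "(\<lambda>(x, y). (H *v x, y)) \<in> borel \<Otimes>\<^sub>M borel \<rightarrow>\<^sub>M borel \<Otimes>\<^sub>M (borel :: (real^'p) measure)"
    unfolding split_beta'
    by (intro measurable_Pair measurable_matrix_vector_mult measurable_fst measurable_snd)
  have "indep_vars (\<lambda>_. borel) (\<lambda>t \<omega>. (\<lambda>(x, y). (H *v x, y)) (w t \<omega>, nu t \<omega>)) UNIV"
    by (rule indep_vars_compose2[OF iv, where Y="\<lambda>_ (x, y). (H *v x, y)"]) (rule hm[unfolded borel_prod])
  then have "indep_vars (\<lambda>_. borel) (\<lambda>t \<omega>. (H *v w t \<omega>, nu t \<omega>)) UNIV" by simp
  then have "distr M (PiM UNIV (\<lambda>_. borel)) (\<lambda>\<omega>. \<lambda>t\<in>UNIV. (H *v w t \<omega>, nu t \<omega>)) =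
      PiM UNIV (\<lambda>t. distr M borel (\<lambda>\<omega>. (H *v w t \<omega>, nu t \<omega>)))"
    by (subst (asm) indep_vars_iff_distr_eq_PiM) (auto intro!: borel_measurable_Pair)
  moreover have "distr M borel (\<lambda>\<omega>. (H *v w t \<omega>, nu t \<omega>)) =
      distr M borel (\<lambda>\<omega>. H *v w t \<omega>) \<Otimes>\<^sub>M distr M borel (nu t)" for t
  proof -
    have "distr M borel (\<lambda>\<omega>. (H *v w t \<omega>, nu t \<omega>)) =
        distr (distr M (borel \<Otimes>\<^sub>M borel) (\<lambda>\<omega>. (w t \<omega>, nu t \<omega>))) (borel \<Otimes>\<^sub>M borel) (\<lambda>(x, y). (H *v x, y))"
      by (subst distr_distr) (auto simp: comp_def borel_prod[symmetric])
    also have "\<dots> = distr (distr M borel (w t) \<Otimes>\<^sub>M distr M borel (nu t)) (borel \<Otimes>\<^sub>M borel) (\<lambda>(x, y). (H *v x, y))"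
      using nm by (simp add: noise_model_def)
    also have "\<dots> = distr (distr M borel (w t)) borel ((*v) H) \<Otimes>\<^sub>M distr (distr M borel (nu t)) borel (\<lambda>y. y)"
      by (rule pair_measure_distr[symmetric])
        (auto intro!: prob_space_imp_sigma_finite prob_space.prob_space_distr prob_space_axioms)
    also have "\<dots> = distr M borel (\<lambda>\<omega>. H *v w t \<omega>) \<Otimes>\<^sub>M distr M borel (nu t)"
      by (simp add: distr_distr comp_def)
    finally show ?thesis .
  qed
  ultimately show ?thesis by (simp add: restrict_UNIV)
qed

lemma noise_model_gauss_char:
  assumes nm: "noise_model M w mu nu Psi"
  shows "gauss_char M (\<lambda>\<omega>. H *v w t \<omega>) (H *v mu) (\<lambda>a. (norm (transpose H *v a))\<^sup>2)"
proof -
  have "gauss_char M (w t) mu (\<lambda>a. a \<bullet> (mat 1 *v a))"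
    using nm by (intro gauss_char_gaussian_vec) (auto simp: noise_model_def)
  from gauss_char_affine[OF this, of 0 H] show ?thesis
    by (simp add: power2_norm_eq_inner)
qed

lemma noise_model_law_eq:
  fixes H1 :: "real^'l1^'r" and H2 :: "real^'l2^'r"
  assumes nm1: "noise_model M1 w1 mu1 nu1 Psi" and nm2: "noise_model M2 w2 mu2 nu2 Psi"
    and mean: "H1 *v mu1 = H2 *v mu2"
    and cov: "\<And>a. norm (transpose H1 *v a) = norm (transpose H2 *v a)"
  shows "distr M1 (PiM UNIV (\<lambda>_. borel)) (\<lambda>\<omega> t. (H1 *v w1 t \<omega>, nu1 t \<omega>)) =
    distr M2 (PiM UNIV (\<lambda>_. borel)) (\<lambda>\<omega> t. (H2 *v w2 t \<omega>, nu2 t \<omega>))"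
proof -
  have ps: "prob_space M1" "prob_space M2"
    using nm1 nm2 by (auto simp: noise_model_def)
  have "distr M1 borel (\<lambda>\<omega>. H1 *v w1 t \<omega>) = distr M2 borel (\<lambda>\<omega>. H2 *v w2 t \<omega>)" for t
    by (rule gauss_char_distr_eq[OF ps noise_model_gauss_char[OF nm1]])
      (use noise_model_gauss_char[OF nm2, where H=H2] in \<open>simp only: mean cov\<close>)
  moreover have "distr M1 borel (nu1 t) = distr M2 borel (nu2 t)" for t
    by (rule gauss_char_distr_eq[OF ps])
      (use nm1 nm2 in \<open>auto intro!: gauss_char_gaussian_vec ps simp: noise_model_def\<close>)
  ultimately show ?thesis by (simp only: noise_model_image_law[OF nm1] noise_model_image_law[OF nm2])
qed

text \<open>\<open>L\<close> picks preimages under \<open>R1\<close>, and totality puts every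
  \<open>R2 *v x\<close> in the range of \<open>R1\<close>, so \<open>F1\<close> and
  \<open>F2\<close> descend to one matrix on the quotient. It serves once for the dynamics and once
  for the outputs.\<close>

lemma kernel_relation_factor:
  fixes R1 :: "real^'n1^'r" and R2 :: "real^'n2^'r" and F1 :: "real^'n1^'k" and F2 :: "real^'n2^'k"
  assumes total: "total_rel (kerrel R1 R2)"
    and F: "\<And>x1 x2. R1 *v x1 = R2 *v x2 \<Longrightarrow> F1 *v x1 = F2 *v x2"
  obtains K :: "real^'r^'k" where "\<And>x. F1 *v x = K *v (R1 *v x)" "\<And>x. F2 *v x = K *v (R2 *v x)"
proof -
  obtain L where L: "linear L" "\<And>x. R1 *v L (R1 *v x) = R1 *v x"
    using linear_exists_right_inverse_on[OF matrix_vector_mul_linear[of R1] subspace_UNIV] by auto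
  define K where "K = F1 ** matrix L"
  have K: "K *v y = F1 *v L y" for y
    by (simp add: K_def matrix_vector_mul_assoc[symmetric] matrix_works linear_matrix_vector_mul_eq L(1))
  show ?thesis
  proof
    fix x
    \<comment> \<open>The pair of this difference and 0 lies in the relation, so \<open>F1\<close>
      vanishes on the difference.\<close>
    have "R1 *v (x - L (R1 *v x)) = R2 *v 0" by (simp add: matrix_vector_mult_diff_distrib L(2))
    from F[OF this] show "F1 *v x = K *v (R1 *v x)" by (simp add: K matrix_vector_mult_diff_distrib)
  next
    fix x
    obtain x1 where "R1 *v x1 = R2 *v x"
      using total by (auto simp: total_rel_def kerrel_def)
    then have "R1 *v L (R2 *v x) = R2 *v x" using L(2) by metis
    from F[OF this] show "F2 *v x = K *v (R2 *v x)" by (simp add: K)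
  qed
qed

text \<open>The common quotient dynamics: \<open>R\<^sub>i x\<^sub>i(t)\<close> is this recursion driven by \<open>(R\<^sub>i G\<^sub>i w\<^sub>i, \<nu>\<^sub>i)\<close>.\<close>

primrec quotient_state :: "real^'r^'r \<Rightarrow> (nat \<Rightarrow> real^'r) \<Rightarrow> real^'r \<Rightarrow> nat \<Rightarrow> (nat \<Rightarrow> (real^'r) \<times> 'b) \<Rightarrow> real^'r" where
  "quotient_state D b z0 0 e = z0"
| "quotient_state D b z0 (Suc t) e = D *v quotient_state D b z0 t e + (b t + fst (e t))"

lemma measurable_borel_pair_components:
  "(\<lambda>e. fst (e t)) \<in> borel_measurable (PiM UNIV (\<lambda>_. borel :: ((real^'r) \<times> (real^'p)) measure))"
  "(\<lambda>e. snd (e t)) \<in> borel_measurable (PiM UNIV (\<lambda>_. borel :: ((real^'r) \<times> (real^'p)) measure))"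
  by (rule measurable_compose[OF measurable_component_singleton[of t]],
      simp, intro borel_measurable_continuous_onI continuous_intros)+

lemma measurable_quotient_state:
  "quotient_state D b z0 t \<in> borel_measurable (PiM UNIV (\<lambda>_. borel :: ((real^'r) \<times> (real^'p)) measure))"
proof (induction t)
  case (Suc t)
  note [measurable] = Suc measurable_borel_pair_components(1)
  show ?case unfolding quotient_state.simps[abs_def] by measurable
qed simp

lemma quotient_state_state:
  assumes "\<And>x. R *v (A *v x) = D *v (R *v x)"
  shows "R *v state A B G w x0 u t \<omega> =
    quotient_state D (\<lambda>t. R ** B *v u t) (R *v x0) t (\<lambda>t. (R ** G *v w t \<omega>, nu t \<omega>))"
  by (induction t)
    (simp_all add: state_0 state_Suc matrix_vector_right_distrib assms matrix_vector_mul_assoc[symmetric])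

text \<open>\<open>R1\<close> is injective on the affine set \<open>c + V\<close> that carries
  \<open>X1\<close>, so \<open>X1\<close> is a function of \<open>R1 *v X1\<close>. Every event for
  \<open>X1\<close> thus becomes one for the quotient variable, whose law the two systems
  share.\<close>

lemma supp_transfer:
  fixes R1 :: "real^'n1^'r" and R2 :: "real^'n2^'r"
  assumes "prob_space M1" "prob_space M2"
    and [measurable]: "X1 \<in> borel_measurable M1" "X2 \<in> borel_measurable M2"
    and law: "distr M1 borel (\<lambda>\<omega>. R1 *v X1 \<omega>) = distr M2 borel (\<lambda>\<omega>. R2 *v X2 \<omega>)"
    and V: "subspace V" "V \<inter> {x. R1 *v x = 0} = {0}" "\<And>\<omega>. X1 \<omega> - c \<in> V"
    and [measurable]: "S \<in> sets borel"
  shows "measure M1 {\<omega> \<in> space M1. X1 \<omega> \<in> S} =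
    measure M2 {\<omega> \<in> space M2. X2 \<omega> \<in> kerrel R1 R2 `` (S \<inter> supp M1 X1)}"
proof -
  interpret M1: prob_space M1 by fact
  interpret M2: prob_space M2 by fact
  have "inj_on ((*v) R1) V"
  proof (rule inj_onI)
    fix x y assume "x \<in> V" "y \<in> V" "R1 *v x = R1 *v y"
    then have "x - y \<in> V \<inter> {x. R1 *v x = 0}"
      using V(1) by (auto simp: matrix_vector_mult_diff_distrib subspace_diff)
    then show "x = y" using V(2) by auto
  qed
  then obtain L where L: "linear L" "\<And>v. v \<in> V \<Longrightarrow> L (R1 *v v) = v"
    using linear_exists_left_inverse_on[OF matrix_vector_mul_linear[of R1] V(1)] by auto
  have [measurable]: "L \<in> borel_measurable borel"
    using L(1) by (intro borel_measurable_continuous_onI linear_continuous_on) (simp add: linear_conv_bounded_linear)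
  define \<phi> where "\<phi> y = c + L (y - R1 *v c)" for y
  have [measurable]: "\<phi> \<in> borel_measurable borel" unfolding \<phi>_def by measurable
  have \<phi>: "\<phi> (R1 *v x) = x" if "x - c \<in> V" for x
    using L(2)[OF that] by (simp add: \<phi>_def matrix_vector_mult_diff_distrib)
  have [measurable]: "supp M1 X1 \<in> sets borel"
    by (intro borel_closed closed_supp assms)
  have supp_V: "x - c \<in> V" if "x \<in> supp M1 X1" for x
  proof -
    have "supp M1 X1 \<subseteq> (+) c ` V"
    proof (rule supp_subset_closed)
      show "closed ((+) c ` V)" by (intro closed_translation closed_subspace V)
      show "X1 \<omega> \<in> (+) c ` V" for \<omega> using V(3)[of \<omega>] by (metis add.commute diff_add_cancel imageI)
    qed
    with that show ?thesis by auto
  qed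
  \<comment> \<open>The image of \<open>S \<inter> supp M1 X1\<close> under \<open>R1\<close>; the
    form via \<open>\<phi>\<close> exhibits it as a Borel set.\<close>
  define T where "T = {y. \<phi> y \<in> S \<inter> supp M1 X1 \<and> R1 *v \<phi> y = y}"
  have [measurable]: "T \<in> sets borel" unfolding T_def by measurable
  have X2T: "x2 \<in> kerrel R1 R2 `` (S \<inter> supp M1 X1) \<longleftrightarrow> R2 *v x2 \<in> T" for x2
  proof
    assume "x2 \<in> kerrel R1 R2 `` (S \<inter> supp M1 X1)"
    then obtain x1 where x1: "x1 \<in> S \<inter> supp M1 X1" "R1 *v x1 = R2 *v x2" by (auto simp: kerrel_def)
    then have "\<phi> (R2 *v x2) = x1" using \<phi> supp_V by (metis Int_iff)
    with x1 show "R2 *v x2 \<in> T" by (simp add: T_def)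
  next
    assume "R2 *v x2 \<in> T"
    then show "x2 \<in> kerrel R1 R2 `` (S \<inter> supp M1 X1)" by (auto simp: T_def kerrel_def)
  qed
  have "measure M1 {\<omega> \<in> space M1. X1 \<omega> \<in> S} = measure M1 {\<omega> \<in> space M1. R1 *v X1 \<omega> \<in> T}"
  proof (rule M1.finite_measure_eq_AE)
    show "AE \<omega> in M1. \<omega> \<in> {\<omega> \<in> space M1. X1 \<omega> \<in> S} \<longleftrightarrow> \<omega> \<in> {\<omega> \<in> space M1. R1 *v X1 \<omega> \<in> T}"
      using AE_in_supp[OF assms(1,3)] by (rule eventually_mono) (auto simp: T_def \<phi>[OF V(3)])
  qed measurable
  also have "\<dots> = measure (distr M1 borel (\<lambda>\<omega>. R1 *v X1 \<omega>)) T"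
    by (subst measure_distr) (auto intro!: arg_cong[where f="measure M1"])
  also have "\<dots> = measure M2 {\<omega> \<in> space M2. R2 *v X2 \<omega> \<in> T}"
    unfolding law by (subst measure_distr) (auto intro!: arg_cong[where f="measure M2"])
  also have "\<dots> = measure M2 {\<omega> \<in> space M2. X2 \<omega> \<in> kerrel R1 R2 `` (S \<inter> supp M1 X1)}"
    by (simp only: X2T)
  finally show ?thesis .
qed

section \<open>Necessity: from bisimulation to laws and matrix identities\<close>

lemma quotient_law_le:
  fixes R1 :: "real^'n1^'r" and R2 :: "real^'n2^'r"
  assumes "prob_space M1" "prob_space M2"
    and [measurable]: "X1 \<in> borel_measurable M1" "X2 \<in> borel_measurable M2"
    and bisim: "\<And>S. S \<in> sets borel \<Longrightarrow> measure M1 {\<omega> \<in> space M1. X1 \<omega> \<in> S} =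
      measure M2 {\<omega> \<in> space M2. X2 \<omega> \<in> kerrel R1 R2 `` (S \<inter> supp M1 X1)}"
    and [measurable]: "T \<in> sets borel"
  shows "measure M1 {\<omega> \<in> space M1. R1 *v X1 \<omega> \<in> T} \<le> measure M2 {\<omega> \<in> space M2. R2 *v X2 \<omega> \<in> T}"
proof -
  interpret M2: prob_space M2 by fact
  let ?S = "{x. R1 *v x \<in> T}"
  have S: "?S \<in> sets borel" by measurable
  have "measure M1 {\<omega> \<in> space M1. R1 *v X1 \<omega> \<in> T} =
      measure M2 {\<omega> \<in> space M2. X2 \<omega> \<in> kerrel R1 R2 `` (?S \<inter> supp M1 X1)}"
    using bisim[OF S] by simp
  also have "\<dots> \<le> measure M2 {\<omega> \<in> space M2. R2 *v X2 \<omega> \<in> T}"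
    by (rule M2.finite_measure_mono) (auto simp: kerrel_def)
  finally show ?thesis .
qed

lemma converse_kerrel: "converse (kerrel R1 R2) = kerrel R2 R1"
  by (auto simp: kerrel_def)

text \<open>Bisimulation applied to the \<open>R1\<close>-preimage of \<open>T\<close> gives only an
  inclusion of events, hence an inequality of measures; exchanging the systems gives the reverse
  one.\<close>

lemma quotient_law_eq:
  fixes R1 :: "real^'n1^'r" and R2 :: "real^'n2^'r"
  assumes ps: "prob_space M1" "prob_space M2"
    and meas [measurable]: "X1 \<in> borel_measurable M1" "X2 \<in> borel_measurable M2"
    and bisim1: "\<And>S. S \<in> sets borel \<Longrightarrow> measure M1 {\<omega> \<in> space M1. X1 \<omega> \<in> S} =
      measure M2 {\<omega> \<in> space M2. X2 \<omega> \<in> kerrel R1 R2 `` (S \<inter> supp M1 X1)}"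
    and bisim2: "\<And>S. S \<in> sets borel \<Longrightarrow> measure M2 {\<omega> \<in> space M2. X2 \<omega> \<in> S} =
      measure M1 {\<omega> \<in> space M1. X1 \<omega> \<in> kerrel R2 R1 `` (S \<inter> supp M2 X2)}"
  shows "distr M1 borel (\<lambda>\<omega>. R1 *v X1 \<omega>) = distr M2 borel (\<lambda>\<omega>. R2 *v X2 \<omega>)"
proof (rule measure_eqI)
  interpret M1: prob_space M1 by fact
  interpret M2: prob_space M2 by fact
  fix T assume "T \<in> sets (distr M1 borel (\<lambda>\<omega>. R1 *v X1 \<omega>))"
  then have T [measurable]: "T \<in> sets borel" by simp
  have "measure M1 {\<omega> \<in> space M1. R1 *v X1 \<omega> \<in> T} = measure M2 {\<omega> \<in> space M2. R2 *v X2 \<omega> \<in> T}"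
    using quotient_law_le[OF ps meas bisim1 T] quotient_law_le[OF ps(2,1) meas(2,1) bisim2 T]
    by simp
  then show "emeasure (distr M1 borel (\<lambda>\<omega>. R1 *v X1 \<omega>)) T = emeasure (distr M2 borel (\<lambda>\<omega>. R2 *v X2 \<omega>)) T"
    by (subst (1 2) emeasure_distr)
      (auto simp: M1.emeasure_eq_measure M2.emeasure_eq_measure vimage_def Int_def conj_commute)
qed simp

text \<open>A direction \<open>v\<close> in the intersection would let every point of the support be moved, without
  changing its \<open>R1\<close>-value, into a half-space that the state misses with positive probability.\<close>

lemma reach_image_inter_kernel:
  fixes A1 :: "real^'n1^'n1" and R1 :: "real^'n1^'r" and R2 :: "real^'n2^'r"
  assumes nm1: "noise_model M1 w1 mu1 nu1 Psi"
    and X1: "X1 = state A1 B1 G1 w1 x0 u CARD('n1)"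
    and bisim: "\<And>S. S \<in> sets borel \<Longrightarrow> measure M1 {\<omega> \<in> space M1. X1 \<omega> \<in> S} =
      measure M2 {\<omega> \<in> space M2. X2 \<omega> \<in> kerrel R1 R2 `` (S \<inter> supp M1 X1)}"
  shows "reach_image A1 G1 \<inter> {x. R1 *v x = 0} = {0}"
proof -
  interpret M1: prob_space M1 using nm1 by (simp add: noise_model_def)
  let ?n = "CARD('n1)"
  let ?H = "\<lambda>k. matpow A1 k ** G1"
  define q where "q a = (\<Sum>\<tau><?n. (norm (transpose (?H (?n - 1 - \<tau>)) *v a))\<^sup>2)" for a
  note g = gauss_char_state[OF nm1, of A1 B1 G1 x0 u ?n, folded X1 q_def]
  have [measurable]: "X1 \<in> borel_measurable M1" using g by (simp add: gauss_char_def)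
  have hom: "q (c *\<^sub>R a) = c\<^sup>2 * q a" for c a
    by (simp add: q_def matrix_vector_mult_scaleR power_mult_distrib sum_distrib_left del: transpose_matrix_vector)
  have False if v: "v \<in> reach_image A1 G1" "R1 *v v = 0" "v \<noteq> 0" for v
  proof -
    obtain f where f: "v = (\<Sum>k<?n. ?H k *v f k)" using v(1) by (auto simp: reach_image_def)
    have orth: "a \<bullet> v = 0" if "q a = 0" for a
    proof -
      \<comment> \<open>\<open>q\<close> is a sum of squares, so every transposed block annihilates
        a direction of zero variance.\<close>
      have z: "transpose (?H (?n - 1 - \<tau>)) *v a = 0" if "\<tau> < ?n" for \<tau>
        using \<open>q a = 0\<close> that unfolding q_def by (subst (asm) sum_nonneg_eq_0_iff) auto
      have "transpose (?H k) *v a = 0" if "k < ?n" for k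
        using z[of "?n - 1 - k"] that by simp
      moreover have "a \<bullet> (?H k *v f k) = (transpose (?H k) *v a) \<bullet> f k" for k
        by (simp add: dot_lmul_matrix)
      ultimately show ?thesis by (simp add: f inner_sum_right)
    qed
    have shift: "z + k *\<^sub>R v \<in> supp M1 X1" if "z \<in> supp M1 X1" for z k
      by (rule gauss_char_supp_shift[OF M1.prob_space_axioms g hom _ that]) (simp add: orth)
    let ?S = "{x. 0 \<le> x \<bullet> v}"
    have S: "?S \<in> sets borel" by measurable
    have vv: "v \<bullet> v > 0" using v(3) by simp
    have "kerrel R1 R2 `` (?S \<inter> supp M1 X1) = kerrel R1 R2 `` (UNIV \<inter> supp M1 X1)"
    proof (intro equalityI subsetI)
      fix x2 assume "x2 \<in> kerrel R1 R2 `` (UNIV \<inter> supp M1 X1)"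
      then obtain x1 where x1: "x1 \<in> supp M1 X1" "R1 *v x1 = R2 *v x2" by (auto simp: kerrel_def)
      \<comment> \<open>This multiple of \<open>v\<close> raises the inner product with
        \<open>v\<close> to \<open>x1 \<bullet> v + \<bar>x1 \<bullet> v\<bar>\<close>, which is
        nonnegative.\<close>
      let ?k = "\<bar>x1 \<bullet> v\<bar> / (v \<bullet> v)"
      have "x1 + ?k *\<^sub>R v \<in> ?S \<inter> supp M1 X1"
        using shift[OF x1(1), of ?k] vv by (simp add: inner_add_left)
      moreover have "R1 *v (x1 + ?k *\<^sub>R v) = R2 *v x2"
        using x1(2) v(2) by (simp add: matrix_vector_right_distrib matrix_vector_mult_scaleR)
      ultimately show "x2 \<in> kerrel R1 R2 `` (?S \<inter> supp M1 X1)" unfolding kerrel_def by blast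
    qed auto
    then have "measure M1 {\<omega> \<in> space M1. X1 \<omega> \<in> ?S} = measure M1 {\<omega> \<in> space M1. X1 \<omega> \<in> UNIV}"
      using bisim[OF S] bisim[of UNIV] by simp
    then have one: "measure M1 {\<omega> \<in> space M1. X1 \<omega> \<in> ?S} = 1"
      by (simp add: M1.prob_space)
    have "supp M1 X1 \<noteq> {}"
      using AE_in_supp[OF M1.prob_space_axioms \<open>X1 \<in> borel_measurable M1\<close>] M1.AE_False by auto
    then obtain z where z: "z \<in> supp M1 X1" by auto
    \<comment> \<open>A support point whose inner product with \<open>v\<close> is at most -1. A
      ball around it has positive mass outside \<open>?S\<close>, against
      \<open>one\<close>.\<close>
    define y where "y = z + (- (\<bar>z \<bullet> v\<bar> + 1) / (v \<bullet> v)) *\<^sub>R v"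
    have y: "y \<in> supp M1 X1" unfolding y_def by (rule shift[OF z])
    have yv: "y \<bullet> v < 0" using vv by (simp add: y_def inner_add_left)
    have "open {x. x \<bullet> v < 0}" by (intro open_Collect_less continuous_intros)
    then obtain \<rho> where \<rho>: "\<rho> > 0" "ball y \<rho> \<subseteq> {x. x \<bullet> v < 0}"
      using yv openE[of "{x. x \<bullet> v < 0}" y] by blast
    have "0 < measure M1 {\<omega> \<in> space M1. X1 \<omega> \<in> ball y \<rho>}" by (rule suppD[OF y \<rho>(1)])
    also have "\<dots> \<le> measure M1 (space M1 - {\<omega> \<in> space M1. X1 \<omega> \<in> ?S})"
    proof (rule M1.finite_measure_mono)
      show "{\<omega> \<in> space M1. X1 \<omega> \<in> ball y \<rho>} \<subseteq> space M1 - {\<omega> \<in> space M1. X1 \<omega> \<in> ?S}"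
        using \<rho>(2) by (auto simp del: mem_ball dest!: subsetD)
    qed measurable
    also have "\<dots> = 0" using one by (subst M1.prob_compl) auto
    finally show False by simp
  qed
  moreover have "0 \<in> reach_image A1 G1"
    unfolding reach_image_eq_reach_upto by (rule subspace_0[OF subspace_reach_upto])
  ultimately show ?thesis by auto
qed

text \<open>Polarisation: the quadratic form at \<open>a + b\<close> recovers the symmetric bilinear
  form.\<close>

lemma symmetric_matrix_eqI:
  fixes S T :: "real^'n^'n"
  assumes "transpose S = S" "transpose T = T" "\<And>a. a \<bullet> (S *v a) = a \<bullet> (T *v a)"
  shows "S = T"
proof -
  have sym: "b \<bullet> (S *v a) = a \<bullet> (S *v b)" "b \<bullet> (T *v a) = a \<bullet> (T *v b)" for a b
    using assms(1,2) by (metis dot_lmul_matrix inner_commute transpose_matrix_vector)+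
  have "a \<bullet> (S *v b) = a \<bullet> (T *v b)" for a b
    using assms(3)[of "a + b"] assms(3)[of a] assms(3)[of b] sym[of b a]
    by (simp add: matrix_vector_right_distrib inner_add_left inner_add_right)
  then have "S *v b = T *v b" for b
    by (metis vector_eq_ldot)
  then show ?thesis by (simp add: matrix_eq)
qed

text \<open>Links the matrix products in (h3) to the variance form that \<open>gauss_char\<close>
  carries for the noise seen through \<open>R ** G\<close>.\<close>

lemma covariance_quadratic_form:
  "a \<bullet> (R ** G ** transpose G ** transpose R *v a) = (norm (transpose (R ** G) *v a))\<^sup>2"
  for R :: "real^'n^'r" and G :: "real^'l^'n"
proof -
  have "a \<bullet> (R ** G ** transpose G ** transpose R *v a) = a \<bullet> ((R ** G) *v (transpose (R ** G) *v a))"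
    by (simp add: matrix_transpose_mul matrix_vector_mul_assoc matrix_mul_assoc del: transpose_matrix_vector)
  also have "\<dots> = (norm (transpose (R ** G) *v a))\<^sup>2"
    by (simp add: dot_lmul_matrix[symmetric] power2_norm_eq_inner)
  finally show ?thesis .
qed

text \<open>From the initial state 0, one step leaves only input and noise. The mean depends on
  \<open>u 0\<close> and the variance does not, so varying the input separates \<open>B\<close> from
  \<open>mu\<close>.\<close>

lemma gauss_char_quotient_step:
  fixes R :: "real^'n^'r"
  assumes "noise_model M w mu nu Psi"
  shows "gauss_char M (\<lambda>\<omega>. R *v state A B G w 0 u 1 \<omega>) (R *v (B *v u 0) + R *v (G *v mu))
    (\<lambda>a. (norm (transpose (R ** G) *v a))\<^sup>2)"
  using gauss_char_affine[OF noise_model_gauss_char[OF assms, of "R ** G" 0], of "R *v (B *v u 0)" "mat 1"]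
  by (simp add: state_Suc state_0 matrix_vector_right_distrib matrix_vector_mul_assoc transpose_mat)

lemma distr_compose_eq:
  assumes "distr M E e = distr M' E e'" "e \<in> measurable M E" "e' \<in> measurable M' E" "f \<in> measurable E N"
  shows "distr M N (\<lambda>\<omega>. f (e \<omega>)) = distr M' N (\<lambda>\<omega>. f (e' \<omega>))"
  using arg_cong[OF assms(1), of "\<lambda>P. distr P N f"] assms(2-4) by (simp add: distr_distr comp_def)

lemma stoch_equiv_distr_eq:
  assumes "stoch_equiv M Y N Z" "Y t \<in> borel_measurable M" "Z t \<in> borel_measurable N"
  shows "distr M borel (Y t) = distr N borel (Z t)"
proof -
  have law: "distr M (PiM {t} (\<lambda>_. borel)) (\<lambda>\<omega>. \<lambda>s\<in>{t}. Y s \<omega>) =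
      distr N (PiM {t} (\<lambda>_. borel)) (\<lambda>\<omega>. \<lambda>s\<in>{t}. Z s \<omega>)"
    using assms(1) by (simp add: stoch_equiv_def)
  have meas: "(\<lambda>\<omega>. \<lambda>s\<in>{t}. Y s \<omega>) \<in> measurable M (PiM {t} (\<lambda>_. borel))"
    "(\<lambda>\<omega>. \<lambda>s\<in>{t}. Z s \<omega>) \<in> measurable N (PiM {t} (\<lambda>_. borel))"
    using assms(2,3) by (auto intro!: measurable_restrict)
  from distr_compose_eq[OF law meas measurable_component_singleton[of t]] show ?thesis
    by simp
qed

theorem theorem2:
  fixes A1 :: "real^'n1^'n1" and B1 :: "real^'m^'n1" and G1 :: "real^'l1^'n1"
    and C1 :: "real^'n1^'p" and mu1 :: "real^'l1"
    and A2 :: "real^'n2^'n2" and B2 :: "real^'m^'n2" and G2 :: "real^'l2^'n2"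
    and C2 :: "real^'n2^'p" and mu2 :: "real^'l2"
    and Psi :: "real^'p^'p"
    and M1 :: "'s1 measure" and w1 :: "nat \<Rightarrow> 's1 \<Rightarrow> real^'l1" and nu1 :: "nat \<Rightarrow> 's1 \<Rightarrow> real^'p"
    and M2 :: "'s2 measure" and w2 :: "nat \<Rightarrow> 's2 \<Rightarrow> real^'l2" and nu2 :: "nat \<Rightarrow> 's2 \<Rightarrow> real^'p"
    and R1 :: "real^'n1^'r" and R2 :: "real^'n2^'r"
  assumes Psi_sym: "transpose Psi = Psi"
    and sys1: "noise_model M1 w1 mu1 nu1 Psi"
    and sys2: "noise_model M2 w2 mu2 nu2 Psi"
    and total: "total_rel (kerrel R1 R2)"
    and h0: "\<forall>(x1, x2) \<in> kerrel R1 R2. (A1 *v x1, A2 *v x2) \<in> kerrel R1 R2"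
  shows "stoch_bisim (kerrel R1 R2) A1 B1 G1 C1 M1 w1 nu1 A2 B2 G2 C2 M2 w2 nu2 \<longleftrightarrow>
    (R1 ** B1 = R2 ** B2 \<and>
     R1 *v (G1 *v mu1) = R2 *v (G2 *v mu2) \<and>
     R1 ** G1 ** transpose G1 ** transpose R1 = R2 ** G2 ** transpose G2 ** transpose R2 \<and>
     kerrel R1 R2 \<subseteq> {(x1, x2). C1 *v x1 = C2 *v x2} \<and>
     reach_image A1 G1 \<inter> {x. R1 *v x = 0} = {0} \<and>
     reach_image A2 G2 \<inter> {x. R2 *v x = 0} = {0})"
proof
  have ps: "prob_space M1" "prob_space M2"
    using sys1 sys2 by (auto simp: noise_model_def)
  have meas1: "state A1 B1 G1 w1 x u t \<in> borel_measurable M1" for x u t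
    using gauss_char_state[OF sys1, of A1 B1 G1 x u t] by (simp add: gauss_char_def)
  have meas2: "state A2 B2 G2 w2 x u t \<in> borel_measurable M2" for x u t
    using gauss_char_state[OF sys2, of A2 B2 G2 x u t] by (simp add: gauss_char_def)
  \<comment> \<open>By totality both images are the whole space, so conditions (i) and (ii) apply to
    all Borel sets.\<close>
  have total_UNIV: "kerrel R1 R2 `` UNIV = UNIV" "converse (kerrel R1 R2) `` UNIV = UNIV"
    using total by (auto simp: total_rel_def)
  {
    assume bisim: "stoch_bisim (kerrel R1 R2) A1 B1 G1 C1 M1 w1 nu1 A2 B2 G2 C2 M2 w2 nu2"
    have b1: "measure M1 {\<omega> \<in> space M1. state A1 B1 G1 w1 x1 u t \<omega> \<in> S} =
        measure M2 {\<omega> \<in> space M2. state A2 B2 G2 w2 x2 u t \<omega> \<in>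
          kerrel R1 R2 `` (S \<inter> supp M1 (state A1 B1 G1 w1 x1 u t))}"
      if "(x1, x2) \<in> kerrel R1 R2" "S \<in> sets borel" for x1 x2 u t S
      using bisim that unfolding stoch_bisim_def Let_def total_UNIV by blast
    have b2: "measure M2 {\<omega> \<in> space M2. state A2 B2 G2 w2 x2 u t \<omega> \<in> S} =
        measure M1 {\<omega> \<in> space M1. state A1 B1 G1 w1 x1 u t \<omega> \<in>
          kerrel R2 R1 `` (S \<inter> supp M2 (state A2 B2 G2 w2 x2 u t))}"
      if "(x1, x2) \<in> kerrel R1 R2" "S \<in> sets borel" for x1 x2 u t S
      using bisim that unfolding stoch_bisim_def Let_def total_UNIV converse_kerrel by blast
    have b3: "stoch_equiv M1 (sys_output A1 B1 G1 C1 w1 nu1 x1 u) M2 (sys_output A2 B2 G2 C2 w2 nu2 x2 u)"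
      if "(x1, x2) \<in> kerrel R1 R2" for x1 x2 u
      using bisim that unfolding stoch_bisim_def Let_def by blast
    \<comment> \<open>All conditions except (h4) are read off from this initial pair.\<close>
    have zero: "(0, 0) \<in> kerrel R1 R2" by (simp add: kerrel_def)
    have law: "distr M1 borel (\<lambda>\<omega>. R1 *v state A1 B1 G1 w1 0 u 1 \<omega>) =
        distr M2 borel (\<lambda>\<omega>. R2 *v state A2 B2 G2 w2 0 u 1 \<omega>)" for u
      by (rule quotient_law_eq[OF ps meas1 meas2 b1[OF zero] b2[OF zero]])
    note step = gauss_char_inject[OF gauss_char_quotient_step[OF sys1] gauss_char_quotient_step[OF sys2] law]
    \<comment> \<open>Zero input leaves only the noise means; once these agree, the constant input
      \<open>x\<close> isolates \<open>B1\<close> and \<open>B2\<close>.\<close>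
    have h2: "R1 *v (G1 *v mu1) = R2 *v (G2 *v mu2)"
      using step(1)[of "\<lambda>_. 0"] by simp
    have "R1 *v (B1 *v x) = R2 *v (B2 *v x)" for x
      using step(1)[of "\<lambda>_. x"] h2 by simp
    then have h1: "R1 ** B1 = R2 ** B2"
      by (simp add: matrix_eq matrix_vector_mul_assoc)
    have h3: "R1 ** G1 ** transpose G1 ** transpose R1 = R2 ** G2 ** transpose G2 ** transpose R2"
    proof (rule symmetric_matrix_eqI)
      show "a \<bullet> (R1 ** G1 ** transpose G1 ** transpose R1 *v a) =
          a \<bullet> (R2 ** G2 ** transpose G2 ** transpose R2 *v a)" for a
        using fun_cong[OF step(2), of a] by (simp only: covariance_quadratic_form)
    qed (simp_all add: matrix_transpose_mul matrix_mul_assoc)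
    have h4: "C1 *v x1 = C2 *v x2" if x: "(x1, x2) \<in> kerrel R1 R2" for x1 x2
    proof -
      let ?Y1 = "sys_output A1 B1 G1 C1 w1 nu1 x1 (\<lambda>_. 0)" and ?Y2 = "sys_output A2 B2 G2 C2 w2 nu2 x2 (\<lambda>_. 0)"
      \<comment> \<open>At time 0 the output is a constant plus noise of covariance
        \<open>Psi\<close>, so equality of the laws compares the constants.\<close>
      have g1: "gauss_char M1 (?Y1 0) (C1 *v x1) (\<lambda>a. a \<bullet> (Psi *v a))"
        using gauss_char_affine[of M1 "nu1 0" 0 "\<lambda>a. a \<bullet> (Psi *v a)" "C1 *v x1" "mat 1"] sys1
        by (simp add: sys_output_def[abs_def] state_0 transpose_mat noise_model_def gauss_char_gaussian_vec)
      have g2: "gauss_char M2 (?Y2 0) (C2 *v x2) (\<lambda>a. a \<bullet> (Psi *v a))"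
        using gauss_char_affine[of M2 "nu2 0" 0 "\<lambda>a. a \<bullet> (Psi *v a)" "C2 *v x2" "mat 1"] sys2
        by (simp add: sys_output_def[abs_def] state_0 transpose_mat noise_model_def gauss_char_gaussian_vec)
      have "distr M1 borel (?Y1 0) = distr M2 borel (?Y2 0)"
        using g1 g2 by (intro stoch_equiv_distr_eq[OF b3[OF x]]) (simp_all add: gauss_char_def)
      from gauss_char_inject(1)[OF g1 g2 this] show ?thesis .
    qed
    have h51: "reach_image A1 G1 \<inter> {x. R1 *v x = 0} = {0}"
      by (rule reach_image_inter_kernel[OF sys1 refl b1[OF zero, where u="\<lambda>_. 0"]])
    have h52: "reach_image A2 G2 \<inter> {x. R2 *v x = 0} = {0}"
      by (rule reach_image_inter_kernel[OF sys2 refl b2[OF zero, where u="\<lambda>_. 0"]])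
    show "R1 ** B1 = R2 ** B2 \<and>
       R1 *v (G1 *v mu1) = R2 *v (G2 *v mu2) \<and>
       R1 ** G1 ** transpose G1 ** transpose R1 = R2 ** G2 ** transpose G2 ** transpose R2 \<and>
       kerrel R1 R2 \<subseteq> {(x1, x2). C1 *v x1 = C2 *v x2} \<and>
       reach_image A1 G1 \<inter> {x. R1 *v x = 0} = {0} \<and>
       reach_image A2 G2 \<inter> {x. R2 *v x = 0} = {0}"
      using h1 h2 h3 h4 h51 h52 by auto
  next
    assume "R1 ** B1 = R2 ** B2 \<and>
       R1 *v (G1 *v mu1) = R2 *v (G2 *v mu2) \<and>
       R1 ** G1 ** transpose G1 ** transpose R1 = R2 ** G2 ** transpose G2 ** transpose R2 \<and>
       kerrel R1 R2 \<subseteq> {(x1, x2). C1 *v x1 = C2 *v x2} \<and>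
       reach_image A1 G1 \<inter> {x. R1 *v x = 0} = {0} \<and>
       reach_image A2 G2 \<inter> {x. R2 *v x = 0} = {0}"
    then have h1: "R1 ** B1 = R2 ** B2"
      and h2: "R1 *v (G1 *v mu1) = R2 *v (G2 *v mu2)"
      and h3: "R1 ** G1 ** transpose G1 ** transpose R1 = R2 ** G2 ** transpose G2 ** transpose R2"
      and h4: "kerrel R1 R2 \<subseteq> {(x1, x2). C1 *v x1 = C2 *v x2}"
      and h51: "reach_image A1 G1 \<inter> {x. R1 *v x = 0} = {0}"
      and h52: "reach_image A2 G2 \<inter> {x. R2 *v x = 0} = {0}"
      by blast+
    \<comment> \<open>By (h0) the matrices \<open>R1 ** A1\<close> and \<open>R2 ** A2\<close> agree
      on related states, so both dynamics induce the same quotient matrix \<open>D\<close>; (h4)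
      yields \<open>K\<close> in the same way.\<close>
    obtain D where "\<And>x. R1 ** A1 *v x = D *v (R1 *v x)" "\<And>x. R2 ** A2 *v x = D *v (R2 *v x)"
      by (rule kernel_relation_factor[OF total, of "R1 ** A1" "R2 ** A2"])
        (use h0 in \<open>auto simp: kerrel_def matrix_vector_mul_assoc[symmetric]\<close>)
    then have D1: "\<And>x. R1 *v (A1 *v x) = D *v (R1 *v x)" and D2: "\<And>x. R2 *v (A2 *v x) = D *v (R2 *v x)"
      by (simp_all add: matrix_vector_mul_assoc)
    obtain K where K: "\<And>x. C1 *v x = K *v (R1 *v x)" "\<And>x. C2 *v x = K *v (R2 *v x)"
      by (rule kernel_relation_factor[OF total, of C1 C2]) (use h4 in \<open>auto simp: kerrel_def\<close>)
    let ?E = "PiM UNIV (\<lambda>_. borel) :: (nat \<Rightarrow> (real^'r) \<times> (real^'p)) measure"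
    define E1 where "E1 \<omega> t = (R1 ** G1 *v w1 t \<omega>, nu1 t \<omega>)" for \<omega> t
    define E2 where "E2 \<omega> t = (R2 ** G2 *v w2 t \<omega>, nu2 t \<omega>)" for \<omega> t
    have "norm (transpose (R1 ** G1) *v a) = norm (transpose (R2 ** G2) *v a)" for a
      using arg_cong[OF h3, of "\<lambda>S. a \<bullet> (S *v a)"]
      by (simp only: covariance_quadratic_form power2_eq_iff_nonneg norm_ge_zero)
    then have E_law: "distr M1 ?E E1 = distr M2 ?E E2"
      unfolding E1_def[abs_def] E2_def[abs_def]
      by (intro noise_model_law_eq[OF sys1 sys2]) (simp_all add: h2 matrix_vector_mul_assoc[symmetric])
    have E1_meas: "E1 \<in> measurable M1 ?E"
      using measurable_restrict[of UNIV "\<lambda>t \<omega>. E1 \<omega> t" M1 "\<lambda>_. borel"] noise_model_measurable[OF sys1]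
      by (auto simp: restrict_UNIV E1_def[abs_def] intro!: borel_measurable_Pair measurable_matrix_vector_mult)
    have E2_meas: "E2 \<in> measurable M2 ?E"
      using measurable_restrict[of UNIV "\<lambda>t \<omega>. E2 \<omega> t" M2 "\<lambda>_. borel"] noise_model_measurable[OF sys2]
      by (auto simp: restrict_UNIV E2_def[abs_def] intro!: borel_measurable_Pair measurable_matrix_vector_mult)
    \<comment> \<open>Any measurable functional of the noise path now has the same law for both
      systems.\<close>
    note push = distr_compose_eq[OF E_law E1_meas E2_meas]
    show "stoch_bisim (kerrel R1 R2) A1 B1 G1 C1 M1 w1 nu1 A2 B2 G2 C2 M2 w2 nu2"
      unfolding stoch_bisim_def Let_def converse_kerrel
    proof (intro conjI allI impI ballI)
      show "subspace (kerrel R1 R2)"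
        by (auto simp: subspace_def kerrel_def zero_prod_def matrix_vector_right_distrib matrix_vector_mult_scaleR)
    next
      fix x1 x2 u t assume "(x1, x2) \<in> kerrel R1 R2"
      then have x: "R1 *v x1 = R2 *v x2" by (simp add: kerrel_def)
      let ?Z = "quotient_state D (\<lambda>t. R1 ** B1 *v u t) (R1 *v x1)"
      have Z1: "R1 *v state A1 B1 G1 w1 x1 u t \<omega> = ?Z t (E1 \<omega>)" for t \<omega>
        unfolding E1_def by (rule quotient_state_state[OF D1])
      \<comment> \<open>Relatedness of the initial states and \<open>h1\<close> make
        \<open>?Z\<close> the same functional as for the first system.\<close>
      have Z2: "R2 *v state A2 B2 G2 w2 x2 u t \<omega> = ?Z t (E2 \<omega>)" for t \<omega>
        unfolding E2_def x h1 by (rule quotient_state_state[OF D2])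
      have law: "distr M1 borel (\<lambda>\<omega>. R1 *v state A1 B1 G1 w1 x1 u t \<omega>) =
          distr M2 borel (\<lambda>\<omega>. R2 *v state A2 B2 G2 w2 x2 u t \<omega>)"
        unfolding Z1 Z2 by (rule push[OF measurable_quotient_state])
      note sub = subspace_reach_upto[of A1 G1 "CARD('n1)", folded reach_image_eq_reach_upto]
        subspace_reach_upto[of A2 G2 "CARD('n2)", folded reach_image_eq_reach_upto]
      show "measure M1 {\<omega> \<in> space M1. state A1 B1 G1 w1 x1 u t \<omega> \<in> S} =
          measure M2 {\<omega> \<in> space M2. state A2 B2 G2 w2 x2 u t \<omega> \<in>
            kerrel R1 R2 `` (S \<inter> supp M1 (state A1 B1 G1 w1 x1 u t))}" if "S \<in> sets borel" for S
        by (rule supp_transfer[OF ps meas1 meas2 law sub(1) h51 state_in_reach_image that])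
      show "measure M2 {\<omega> \<in> space M2. state A2 B2 G2 w2 x2 u t \<omega> \<in> S} =
          measure M1 {\<omega> \<in> space M1. state A1 B1 G1 w1 x1 u t \<omega> \<in>
            kerrel R2 R1 `` (S \<inter> supp M2 (state A2 B2 G2 w2 x2 u t))}" if "S \<in> sets borel" for S
        by (rule supp_transfer[OF ps(2,1) meas2 meas1 law[symmetric] sub(2) h52 state_in_reach_image that])
      \<comment> \<open>The outputs too are one functional of the noise path, which settles all
        finite-dimensional laws at once.\<close>
      have Y1: "sys_output A1 B1 G1 C1 w1 nu1 x1 u t \<omega> = K *v ?Z t (E1 \<omega>) + snd (E1 \<omega> t)" for t \<omega>
        unfolding sys_output_def K Z1 by (simp add: E1_def)
      have Y2: "sys_output A2 B2 G2 C2 w2 nu2 x2 u t \<omega> = K *v ?Z t (E2 \<omega>) + snd (E2 \<omega> t)" for t \<omega>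
        unfolding sys_output_def K Z2 by (simp add: E2_def)
      show "stoch_equiv M1 (sys_output A1 B1 G1 C1 w1 nu1 x1 u) M2 (sys_output A2 B2 G2 C2 w2 nu2 x2 u)"
        unfolding stoch_equiv_def Y1 Y2
        by (intro allI impI push measurable_restrict borel_measurable_add measurable_matrix_vector_mult
            measurable_quotient_state measurable_borel_pair_components)
    qed
  }
qed

end
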